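(* For every integer $k \ge 4$ there exist a $k$-uniform hypergraph $F$ and constants $\theta$, $c>0$, $C>0$ with $1 < \theta < m_k(F)$ such that $$\lim_{n\to\infty} \Pr[H^k(n,p) \rightarrow (F)] = \begin{cases} 0 & \text{if } p \le c n^{-1/\theta},\\ 1 & \text{if } p \ge C n^{-1/\theta}.\end{cases}$$
   Context: $H^k(n,p)$ is the random $k$-uniform hypergraph on $n$ vertices in which each $k$-element subset of the vertex set is an edge independently with probability $p$. For hypergraphs $G,F$, $G \rightarrow (F)$ means that every colouring of the edges of $G$ with 2 colours contains a monochromatic copy of $F$ (a subhypergraph isomorphic to $F$ all of whose edges have the same colour). For a $k$-uniform hypergraph $G$ with $e(G)$ edges and $v(G)$ vertices let $d_k(G)=0$ if $e(G)=0$, $d_k(G)=1/k$ if $e(G)=1$ and $v(G)=k$, and $d_k(G)=\frac{e(G)-1}{v(G)-k}$ otherwise; the $k$-density is $m_k(G)=\max_{H\subseteq G} d_k(H)$. *)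

theory Defs
  imports "HOL-Probability.Probability" "HOL-Library.Ramsey"
begin

type_synonym 'a hypergraph = "'a set \<times> 'a set set"

abbreviation hverts :: "'a hypergraph \<Rightarrow> 'a set" where
  "hverts \<equiv> fst"

abbreviation hedges :: "'a hypergraph \<Rightarrow> 'a set set" where
  "hedges \<equiv> snd"

definition uniform_hypergraph :: "nat \<Rightarrow> 'a hypergraph \<Rightarrow> bool" where
  "uniform_hypergraph k G \<longleftrightarrow> finite (hverts G) \<and> hedges G \<subseteq> nsets (hverts G) k"

definition subhypergraph :: "'a hypergraph \<Rightarrow> 'a hypergraph \<Rightarrow> bool" where
  "subhypergraph H G \<longleftrightarrow>
     hverts H \<subseteq> hverts G \<and> hedges H \<subseteq> hedges G \<and> hedges H \<subseteq> Pow (hverts H)"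

definition hypergraph_iso :: "'a hypergraph \<Rightarrow> 'b hypergraph \<Rightarrow> bool" where
  "hypergraph_iso G H \<longleftrightarrow>
     (\<exists>f. bij_betw f (hverts G) (hverts H) \<and> (\<lambda>e. f ` e) ` hedges G = hedges H)"

text \<open>
  The two colours are the elements of \<^typ>\<open>bool\<close>; the values of a colouring outside the
  edge set are irrelevant.
\<close>

definition arrows :: "'a hypergraph \<Rightarrow> 'b hypergraph \<Rightarrow> bool" where
  "arrows G F \<longleftrightarrow>
     (\<forall>col :: 'a set \<Rightarrow> bool. \<exists>H b.
        subhypergraph H G \<and> hypergraph_iso H F \<and> (\<forall>e\<in>hedges H. col e = b))"

definition d_density :: "nat \<Rightarrow> 'a hypergraph \<Rightarrow> real" where
  "d_density k G =
     (if card (hedges G) = 0 then 0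
      else if card (hedges G) = 1 \<and> card (hverts G) = k then 1 / real k
      else (real (card (hedges G)) - 1) / (real (card (hverts G)) - real k))"

definition m_density :: "nat \<Rightarrow> 'a hypergraph \<Rightarrow> real" where
  "m_density k G = Max {d_density k H | H. subhypergraph H G}"

definition random_hypergraph :: "nat \<Rightarrow> nat \<Rightarrow> real \<Rightarrow> nat hypergraph pmf" where
  "random_hypergraph k n p =
     map_pmf (\<lambda>X. ({..<n}, {e \<in> nsets {..<n} k. X e}))
       (Pi_pmf (nsets {..<n} k) False (\<lambda>_. bernoulli_pmf p))"

end

theory Submission
  imports Defs "HOL-Real_Asymp.Real_Asymp"
begin

text \<open>
  The hypergraph \<open>F\<close> is the disjoint union of \<open>F1\<close>, three edges on \<open>k + 1\<close> vertices, and
  \<open>F2\<close>, a star of \<open>t = 12 k\<^sup>2\<close> edges sharing a core of \<open>k - 1\<close> vertices; \<open>\<theta> = 3/2\<close>, while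
  \<open>F1\<close> alone has \<open>k\<close>-density \<open>2\<close>. Both \<open>F1\<close> and \<open>F2\<close> become unavoidable at smaller densities by
  the pigeonhole principle (for \<open>F1\<close> because \<open>k + 1 \<ge> 5\<close> edges on \<open>k + 1\<close> vertices contain three
  of one colour), so the threshold is that of avoiding \<open>F1\<close> in red and \<open>F2\<close> in blue.

  If \<open>p = C n\<^bsup>-2/3\<^esup>\<close>, consider the link graph of a fixed \<open>(k - 2)\<close>-set. A blue colour class
  without \<open>F2\<close> has bounded degree there, hence \<open>O(n)\<close> edges, and almost all triangles are
  edge-disjoint, so it cannot meet all of the about \<open>C\<^sup>3 n\<close> triangles, and a triangle without
  blue edges is a red \<open>F1\<close>.

  If \<open>p = c n\<^bsup>-2/3\<^esup>\<close>, remove edges one by one, colouring an edge red if it lies in no copy of \<open>F1\<close>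
  of the remaining edges, and blue if all of its \<open>(k - 1)\<close>-subsets have degree less than \<open>t\<close> there.
  The process only fails at a stuck set of edges. A stuck set of size \<open>s\<close> spans at most \<open>7 s / 12\<close>
  vertices, so small ones do not occur by the union bound, and exploring a stuck set triple by
  triple reveals a branching structure that is subcritical for small \<open>c\<close>, so that it closes up to a
  small stuck set.
\<close>

section \<open>Stuck edge sets\<close>

definition triple :: "nat \<Rightarrow> 'a set set \<Rightarrow> bool" where
  "triple k T \<longleftrightarrow> card T = 3 \<and> (\<forall>e\<in>T. finite e \<and> card e = k) \<and> card (\<Union>T) = Suc k"

definition stuck :: "nat \<Rightarrow> nat \<Rightarrow> 'a set set \<Rightarrow> bool" where
  "stuck k t E \<longleftrightarrow> E \<noteq> {} \<and>
     (\<forall>e\<in>E. (\<exists>T\<subseteq>E. e \<in> T \<and> triple k T) \<and>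
        (\<exists>S\<subseteq>e. card S = k - 1 \<and> t \<le> card {f \<in> E. S \<subseteq> f}))"

text \<open>Induction on the number of edges runs the removal process backwards. Both alternatives
  for the removed edge \<open>e\<close> refer to all of \<open>E\<close>: if no triple of
  \<open>E\<close> contains \<open>e\<close>, colouring it red creates no red triple; if every
  \<open>(k - 1)\<close>-subset of \<open>e\<close> has degree below \<open>t\<close> in
  \<open>E\<close>, the blue degrees over these subsets stay below \<open>t\<close> whatever the
  other colours are.\<close>

lemma not_stuck_imp_colouring:
  fixes E :: "'a set set"
  assumes "finite E" "0 < t" "\<And>E'. E' \<subseteq> E \<Longrightarrow> \<not> stuck k t E'"
  shows "\<exists>red. (\<forall>T\<subseteq>E. triple k T \<longrightarrow> (\<exists>e\<in>T. \<not> red e)) \<and>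
           (\<forall>S. card S = k - 1 \<longrightarrow> card {f \<in> E. S \<subseteq> f \<and> \<not> red f} < t)"
  using assms(1,3)
proof (induction "card E" arbitrary: E)
  case 0
  then have "E = {}" by simp
  with \<open>0 < t\<close> show ?case by (auto simp: triple_def)
next
  case (Suc m)
  have "E \<noteq> {}" using Suc.hyps by auto
  moreover have "\<not> stuck k t E" using Suc.prems by blast
  ultimately obtain e where e: "e \<in> E" and
    alt: "(\<forall>T\<subseteq>E. e \<in> T \<longrightarrow> \<not> triple k T) \<or>
      (\<forall>S\<subseteq>e. card S = k - 1 \<longrightarrow> card {f \<in> E. S \<subseteq> f} < t)"
    unfolding stuck_def not_le[symmetric] by blast
  have "m = card (E - {e})" using Suc e by simp
  then obtain red where
    red: "\<And>T. T \<subseteq> E - {e} \<Longrightarrow> triple k T \<Longrightarrow> \<exists>e\<in>T. \<not> red e" and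
    blue: "\<And>S. card S = k - 1 \<Longrightarrow> card {f \<in> E - {e}. S \<subseteq> f \<and> \<not> red f} < t"
    using Suc.hyps(1)[of "E - {e}"] Suc.prems by blast
  show ?case
    using alt
  proof
    assume no: "\<forall>T\<subseteq>E. e \<in> T \<longrightarrow> \<not> triple k T"
    let ?c = "red(e := True)"
    have "\<exists>e\<in>T. \<not> ?c e" if "T \<subseteq> E" "triple k T" for T
    proof -
      have "e \<notin> T" using no that by blast
      then show ?thesis using red[of T] that by fastforce
    qed
    moreover have "card {f \<in> E. S \<subseteq> f \<and> \<not> ?c f} < t" if "card S = k - 1" for S
    proof -
      have "{f \<in> E. S \<subseteq> f \<and> \<not> ?c f} = {f \<in> E - {e}. S \<subseteq> f \<and> \<not> red f}" by auto
      then show ?thesis using blue[OF that] by simp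
    qed
    ultimately show ?thesis by blast
  next
    assume light: "\<forall>S\<subseteq>e. card S = k - 1 \<longrightarrow> card {f \<in> E. S \<subseteq> f} < t"
    let ?c = "red(e := False)"
    have "\<exists>e\<in>T. \<not> ?c e" if "T \<subseteq> E" "triple k T" for T
    proof (cases "e \<in> T")
      case False
      then show ?thesis using red[of T] that by fastforce
    qed auto
    moreover have "card {f \<in> E. S \<subseteq> f \<and> \<not> ?c f} < t" if S: "card S = k - 1" for S
    proof (cases "S \<subseteq> e")
      case True
      have "card {f \<in> E. S \<subseteq> f \<and> \<not> ?c f} \<le> card {f \<in> E. S \<subseteq> f}"
        using Suc.prems(1) by (intro card_mono) auto
      also have "\<dots> < t" using light True S by blast
      finally show ?thesis .
    next
      case False
      then have "{f \<in> E. S \<subseteq> f \<and> \<not> ?c f} = {f \<in> E - {e}. S \<subseteq> f \<and> \<not> red f}" by auto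
      then show ?thesis using blue[OF S] by simp
    qed
    ultimately show ?thesis by blast
  qed
qed

text \<open>An edge of \<open>T\<close> that misses \<open>x\<close> must equal
  \<open>\<Union>T - {x}\<close> by cardinality, so at most one of the three edges misses
  \<open>x\<close>.\<close>

lemma triple_two_edges:
  assumes "triple k T" "x \<in> \<Union>T"
  shows "2 \<le> card {e \<in> T. x \<in> e}"
proof -
  have finT: "finite T" and c3: "card T = 3" using assms unfolding triple_def
    by (auto intro: card_ge_0_finite)
  have fin: "finite (\<Union>T)" using assms unfolding triple_def by (auto intro: card_ge_0_finite)
  have "e = \<Union>T - {x}" if "e \<in> T" "x \<notin> e" for e
  proof (rule card_subset_eq)
    show "card e = card (\<Union>T - {x})" using assms that unfolding triple_def by simp
  qed (use fin that in auto)
  then have "{e \<in> T. x \<notin> e} \<subseteq> {\<Union>T - {x}}" by blast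
  from card_mono[OF _ this] have "card {e \<in> T. x \<notin> e} \<le> 1" by simp
  moreover have "card T = card {e \<in> T. x \<in> e} + card {e \<in> T. x \<notin> e}"
    using finT card_Int_Diff[of T "{e. x \<in> e}"] by (simp add: Int_def set_diff_eq)
  ultimately show ?thesis using c3 by simp
qed

lemma double_count:
  assumes "finite A" "finite B"
  shows "(\<Sum>a\<in>A. card {b \<in> B. P a b}) = (\<Sum>b\<in>B. card {a \<in> A. P a b})"
  unfolding card_eq_sum by (rule sum.swap_restrict[OF assms])

text \<open>Call a \<open>(k - 1)\<close>-set heavy if it lies in at least \<open>t\<close> edges. There are few heavy sets, each
  edge has at most one vertex outside their union, and each vertex lies in at least two edges.\<close>

lemma stuck_imp_dense:
  fixes E :: "'a set set"
  assumes st: "stuck k (12 * k^2) E" and finE: "finite E" and k: "k \<ge> 1"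
  shows "12 * card (\<Union>E) \<le> 7 * card E"
proof -
  let ?t = "12 * k^2"
  have ek: "finite e \<and> card e = k" if "e \<in> E" for e
    using st that unfolding stuck_def triple_def by blast
  define H where "H = {S. (\<exists>e\<in>E. S \<subseteq> e) \<and> card S = k - 1 \<and> ?t \<le> card {f \<in> E. S \<subseteq> f}}"
  define U where "U = \<Union>H"
  have finV: "finite (\<Union>E)" using finE ek by auto
  have finH: "finite H"
    by (rule finite_subset[of _ "Pow (\<Union>E)"]) (use finV in \<open>auto simp: H_def\<close>)
  \<comment> \<open>Count pairs of a heavy set and an edge above it: a heavy set lies in at least
    \<open>12 * k^2\<close> edges, while an edge has only \<open>k\<close> subsets of size
    \<open>k - 1\<close>. Hence \<open>12 * k * card H \<le> card E\<close>, and the union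
    \<open>U\<close> has at most \<open>card E / 12\<close> vertices.\<close>
  have "card H * ?t = (\<Sum>S\<in>H. ?t)" by simp
  also have "\<dots> \<le> (\<Sum>S\<in>H. card {f \<in> E. S \<subseteq> f})" by (intro sum_mono) (auto simp: H_def)
  also have "\<dots> = (\<Sum>f\<in>E. card {S \<in> H. S \<subseteq> f})" by (rule double_count[OF finH finE])
  also have "\<dots> \<le> (\<Sum>f\<in>E. k)"
  proof (intro sum_mono)
    fix f assume f: "f \<in> E"
    have "card {S \<in> H. S \<subseteq> f} \<le> card {S. S \<subseteq> f \<and> card S = k - 1}"
      using ek[OF f] by (intro card_mono) (auto simp: H_def)
    also have "\<dots> = k choose (k - 1)" using ek[OF f] n_subsets[of f "k - 1"] by simp
    also have "\<dots> = k" using k binomial_symmetric[of "k - 1" k] by simp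
    finally show "card {S \<in> H. S \<subseteq> f} \<le> k" .
  qed
  finally have "card H * (12 * k) * k \<le> card E * k" by (simp add: power2_eq_square algebra_simps)
  then have hk: "12 * k * card H \<le> card E" using k by (simp add: algebra_simps)
  have subU: "U \<subseteq> \<Union>E" by (auto simp: U_def H_def)
  then have finU: "finite U" using finV by (rule finite_subset)
  have "card U \<le> (\<Sum>S\<in>H. card S)" unfolding U_def by (rule card_Union_le_sum_card)
  also have "\<dots> = (k - 1) * card H" by (simp add: H_def)
  also have "\<dots> \<le> k * card H" by simp
  finally have cU: "12 * card U \<le> card E" using hk by linarith
  let ?W = "\<Union>E - U"
  \<comment> \<open>Count incidences between edges and vertices outside \<open>U\<close>: at least
    two per vertex, at most one per edge, so there are at most \<open>card E / 2\<close> such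
    vertices. The sum 1/2 + 1/12 = 7/12 stays below 2/3, the exponent in \<open>p\<close>, which is
    what the union bound over small stuck sets requires.\<close>
  have "2 * card ?W = (\<Sum>x\<in>?W. 2)" by simp
  also have "\<dots> \<le> (\<Sum>x\<in>?W. card {e \<in> E. x \<in> e})"
  proof (intro sum_mono)
    fix x assume "x \<in> ?W"
    then obtain e T where "x \<in> e" "e \<in> T" "T \<subseteq> E" "triple k T"
      using st unfolding stuck_def by blast
    then have "2 \<le> card {e \<in> T. x \<in> e}" by (intro triple_two_edges) auto
    also have "\<dots> \<le> card {e \<in> E. x \<in> e}" using finE \<open>T \<subseteq> E\<close> by (intro card_mono) auto
    finally show "2 \<le> card {e \<in> E. x \<in> e}" .
  qed
  also have "\<dots> = (\<Sum>e\<in>E. card {x \<in> ?W. x \<in> e})"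
    using finV finE by (intro double_count) auto
  also have "\<dots> \<le> (\<Sum>e\<in>E. 1)"
  proof (intro sum_mono)
    fix e assume e: "e \<in> E"
    then obtain S where S: "S \<subseteq> e" "S \<in> H" using st unfolding stuck_def H_def by blast
    then have "card (e - S) = 1" using ek[OF e] k
      by (simp add: card_Diff_subset finite_subset H_def)
    moreover have "{x \<in> ?W. x \<in> e} \<subseteq> e - S" using S by (auto simp: U_def)
    ultimately show "card {x \<in> ?W. x \<in> e} \<le> 1" using ek[OF e] card_mono[of "e - S"] by fastforce
  qed
  finally have "2 * card ?W \<le> card E" by simp
  moreover have "card (\<Union>E) = card ?W + card U"
    using finV finU subU by (metis Diff_partition Diff_disjoint Un_commute card_Un_disjoint finite_Diff inf_commute)
  ultimately show ?thesis using cU by linarith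
qed

section \<open>Independent Bernoulli variables\<close>

text \<open>The product space behind \<open>random_hypergraph\<close>, over an arbitrary index set
  so that an induction can split off single coordinates.\<close>

definition bern :: "'e set \<Rightarrow> real \<Rightarrow> ('e \<Rightarrow> bool) pmf" where
  "bern I p = Pi_pmf I False (\<lambda>_. bernoulli_pmf p)"

text \<open>Counting indices rather than sets makes the square of a count again a count, namely of
  pairs of indices with the unions as their sets; the second moment is then just another first
  moment.\<close>

definition ncontained :: "('j \<Rightarrow> 'e set) \<Rightarrow> 'j set \<Rightarrow> ('e \<Rightarrow> bool) \<Rightarrow> nat" where
  "ncontained A J X = card {j \<in> J. \<forall>e\<in>A j. X e}"

lemma finite_set_pmf_bern: "finite I \<Longrightarrow> finite (set_pmf (bern I p))"
  unfolding bern_def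
  by (rule finite_subset[OF set_Pi_pmf_subset'])
     (auto intro!: finite_PiE_dflt intro: finite_subset[OF subset_UNIV])

lemma prob_bern_superset:
  assumes "finite I" "A \<subseteq> I" "0 \<le> p" "p \<le> 1"
  shows "measure_pmf.prob (bern I p) {X. \<forall>e\<in>A. X e} = p ^ card A"
proof -
  have "{X. \<forall>e\<in>A. X e} = Pi I (\<lambda>e. if e \<in> A then {True} else UNIV)"
    using assms(2) by (fastforce simp: Pi_def)
  also have "measure_pmf.prob (bern I p) \<dots> =
      (\<Prod>e\<in>I. measure_pmf.prob (bernoulli_pmf p) (if e \<in> A then {True} else UNIV))"
    unfolding bern_def using assms(1) by (rule measure_Pi_pmf_Pi)
  also have "\<dots> = (\<Prod>e\<in>I. if e \<in> A then p else 1)"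
    using assms by (intro prod.cong) (auto simp: measure_pmf_single)
  also have "\<dots> = (\<Prod>e\<in>A. p)"
    using assms(1,2) by (simp add: prod.If_cases Int_absorb1)
  finally show ?thesis by simp
qed

lemma prob_bern_union_bound:
  assumes "finite I" "finite R" "\<And>r. r \<in> R \<Longrightarrow> A r \<subseteq> I" "0 \<le> p" "p \<le> 1"
  shows "measure_pmf.prob (bern I p) {X. \<exists>r\<in>R. \<forall>e\<in>A r. X e} \<le> (\<Sum>r\<in>R. p ^ card (A r))"
proof -
  have "{X. \<exists>r\<in>R. \<forall>e\<in>A r. X e} = (\<Union>r\<in>R. {X. \<forall>e\<in>A r. X e})" by auto
  also have "measure_pmf.prob (bern I p) \<dots> \<le>
      (\<Sum>r\<in>R. measure_pmf.prob (bern I p) {X. \<forall>e\<in>A r. X e})"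
    using assms(2) by (intro measure_pmf.finite_measure_subadditive_finite) auto
  also have "\<dots> = (\<Sum>r\<in>R. p ^ card (A r))"
    using assms by (intro sum.cong refl prob_bern_superset) auto
  finally show ?thesis .
qed

text \<open>Condition on one coordinate \<open>x\<close>. By induction both conditional
  probabilities grow when \<open>p\<close> is replaced by \<open>q\<close> on the other coordinates;
  the remaining expression is affine in the bias of \<open>x\<close>, with slope
  \<open>c - d\<close>, nonnegative because \<open>P\<close> is increasing.\<close>

lemma prob_bern_mono:
  assumes "finite I" "0 \<le> p" "p \<le> q" "q \<le> 1"
    and "\<And>X Y. (\<And>e. X e \<Longrightarrow> Y e) \<Longrightarrow> P X \<Longrightarrow> P Y"
  shows "measure_pmf.prob (bern I p) {X. P X} \<le> measure_pmf.prob (bern I q) {X. P X}"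
  using assms(1,5)
proof (induction I arbitrary: P rule: finite_induct)
  case empty
  show ?case by (simp add: bern_def)
next
  case (insert x I)
  have split: "measure_pmf.prob (bern (insert x I) r) {X. P X} =
      r * measure_pmf.prob (bern I r) {X. P (X(x := True))} +
      (1 - r) * measure_pmf.prob (bern I r) {X. P (X(x := False))}"
    if "0 \<le> r" "r \<le> 1" for r
  proof -
    have eq: "bern (insert x I) r =
        bind_pmf (bernoulli_pmf r) (\<lambda>y. map_pmf (\<lambda>f. f(x := y)) (bern I r))"
      using insert.hyps unfolding bern_def by (subst Pi_pmf_insert') (auto simp: map_pmf_def)
    have "measure_pmf.prob (bern (insert x I) r) {X. P X} =
        measure_pmf.expectation (bernoulli_pmf r)
          (\<lambda>y. measure_pmf.prob (map_pmf (\<lambda>f. f(x := y)) (bern I r)) {X. P X})"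
      unfolding eq measure_pmf_bind
      by (rule measure_pmf.measure_bind[where N = "count_space UNIV"])
         (auto simp: measure_pmf_in_subprob_algebra)
    then show ?thesis using that by (simp add: vimage_def)
  qed
  let ?T = "\<lambda>X. P (X(x := True))" and ?F = "\<lambda>X. P (X(x := False))"
  have up: "P (Y(x := z))" if "\<And>e. X e \<Longrightarrow> Y e" "P (X(x := z))" for X Y z
  proof (rule insert.prems[of "X(x := z)"])
    show "(Y(x := z)) e" if "(X(x := z)) e" for e
      using that \<open>\<And>e. X e \<Longrightarrow> Y e\<close> by (auto split: if_splits)
  qed fact
  have T: "measure_pmf.prob (bern I p) {X. ?T X} \<le> measure_pmf.prob (bern I q) {X. ?T X}"
    by (rule insert.IH) (fact up)
  have F: "measure_pmf.prob (bern I p) {X. ?F X} \<le> measure_pmf.prob (bern I q) {X. ?F X}"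
    by (rule insert.IH) (fact up)
  have "?T X" if "?F X" for X
  proof (rule insert.prems[of "X(x := False)"])
    show "(X(x := True)) e" if "(X(x := False)) e" for e
      using that by (auto split: if_splits)
  qed fact
  then have FT: "measure_pmf.prob (bern I q) {X. ?F X} \<le> measure_pmf.prob (bern I q) {X. ?T X}"
    by (intro measure_pmf.finite_measure_mono) auto
  define a b c d where "a = measure_pmf.prob (bern I p) {X. ?T X}"
    and "b = measure_pmf.prob (bern I p) {X. ?F X}"
    and "c = measure_pmf.prob (bern I q) {X. ?T X}"
    and "d = measure_pmf.prob (bern I q) {X. ?F X}"
  have "p * a + (1 - p) * b \<le> p * c + (1 - p) * d"
    using T F assms by (intro add_mono mult_left_mono) (auto simp: a_def b_def c_def d_def)
  also have "\<dots> = d + p * (c - d)" by (simp add: algebra_simps)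
  also have "\<dots> \<le> d + q * (c - d)"
    using FT assms by (intro add_mono mult_right_mono) (auto simp: c_def d_def)
  also have "\<dots> = q * c + (1 - q) * d" by (simp add: algebra_simps)
  finally show ?case using split[of p] split[of q] assms by (simp add: a_def b_def c_def d_def)
qed

lemma ncontained_eq_sum:
  "finite J \<Longrightarrow> real (ncontained A J X) = (\<Sum>j\<in>J. indicator {X. \<forall>e\<in>A j. X e} X)"
  by (simp add: ncontained_def indicator_def sum.If_cases Int_def)

lemma expectation_ncontained:
  assumes "finite I" "finite J" "\<And>j. j \<in> J \<Longrightarrow> A j \<subseteq> I" "0 \<le> p" "p \<le> 1"
  shows "measure_pmf.expectation (bern I p) (\<lambda>X. real (ncontained A J X)) =
    (\<Sum>j\<in>J. p ^ card (A j))"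
proof -
  have "measure_pmf.expectation (bern I p) (\<lambda>X. real (ncontained A J X)) =
      (\<Sum>j\<in>J. measure_pmf.prob (bern I p) {X. \<forall>e\<in>A j. X e})"
    using assms by (simp add: ncontained_eq_sum integrable_measure_pmf_finite finite_set_pmf_bern)
  then show ?thesis using assms by (simp add: prob_bern_superset)
qed

lemma prob_ncontained_ge:
  assumes "finite I" "finite J" "\<And>j. j \<in> J \<Longrightarrow> A j \<subseteq> I" "0 \<le> p" "p \<le> 1" "0 < a"
  shows "measure_pmf.prob (bern I p) {X. a \<le> real (ncontained A J X)} \<le>
    (\<Sum>j\<in>J. p ^ card (A j)) / a"
  using integral_Markov_inequality_measure[of "measure_pmf (bern I p)"
      "\<lambda>X. real (ncontained A J X)" "{}" a] assms
  by (simp add: expectation_ncontained integrable_measure_pmf_finite finite_set_pmf_bern)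

text \<open>Chebyshev's inequality; only pairs of overlapping sets contribute to the variance.\<close>

lemma prob_ncontained_le_half:
  fixes p :: real
  assumes "finite I" "finite J" "\<And>j. j \<in> J \<Longrightarrow> A j \<subseteq> I" "0 \<le> p" "p \<le> 1"
    and \<mu>: "\<mu> = (\<Sum>j\<in>J. p ^ card (A j))" "0 < \<mu>"
    and \<Delta>: "(\<Sum>(i, j) \<in> {(i, j) \<in> J \<times> J. A i \<inter> A j \<noteq> {}}. p ^ card (A i \<union> A j)) \<le> \<Delta>"
  shows "measure_pmf.prob (bern I p) {X. real (ncontained A J X) \<le> \<mu> / 2} \<le> 4 * \<Delta> / \<mu>\<^sup>2"
proof -
  let ?M = "bern I p" and ?f = "\<lambda>X. real (ncontained A J X)"
  have int: "integrable (measure_pmf ?M) g" for g :: "_ \<Rightarrow> real"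
    using assms(1) by (simp add: integrable_measure_pmf_finite finite_set_pmf_bern)
  have E: "measure_pmf.expectation ?M ?f = \<mu>"
    using assms by (simp add: expectation_ncontained)
  have sq: "(?f X)\<^sup>2 = real (ncontained (\<lambda>(i, j). A i \<union> A j) (J \<times> J) X)" for X
  proof -
    have "{x \<in> J \<times> J. \<forall>e\<in>case x of (i, j) \<Rightarrow> A i \<union> A j. X e} =
        {j \<in> J. \<forall>e\<in>A j. X e} \<times> {j \<in> J. \<forall>e\<in>A j. X e}" by auto
    then show ?thesis
      by (simp add: ncontained_def card_cartesian_product power2_eq_square)
  qed
  have "measure_pmf.expectation ?M (\<lambda>X. (?f X)\<^sup>2) =
      (\<Sum>x\<in>J \<times> J. p ^ card (case x of (i, j) \<Rightarrow> A i \<union> A j))"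
    unfolding sq using assms by (intro expectation_ncontained) auto
  also have "\<dots> = (\<Sum>x\<in>{(i, j) \<in> J \<times> J. A i \<inter> A j \<noteq> {}}. p ^ card (case x of (i, j) \<Rightarrow> A i \<union> A j)) +
      (\<Sum>x\<in>{(i, j) \<in> J \<times> J. A i \<inter> A j = {}}. p ^ card (case x of (i, j) \<Rightarrow> A i \<union> A j))"
    using assms(2) by (subst sum.union_disjoint[symmetric]) (auto intro!: sum.cong intro: finite_subset[of _ "J \<times> J"])
  \<comment> \<open>Disjoint pairs are independent, so their terms factor; enlarging their sum to
    all pairs adds only nonnegative terms and gives the square of \<open>\<mu>\<close>. What remains
    for the variance is at most \<open>\<Delta>\<close>.\<close>
  also have "\<dots> \<le> \<Delta> + (\<Sum>(i, j)\<in>J \<times> J. p ^ card (A i) * p ^ card (A j))"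
  proof (intro add_mono)
    show "(\<Sum>x\<in>{(i, j) \<in> J \<times> J. A i \<inter> A j \<noteq> {}}. p ^ card (case x of (i, j) \<Rightarrow> A i \<union> A j)) \<le> \<Delta>"
      using \<Delta> by (simp add: case_prod_unfold)
    have "(\<Sum>x\<in>{(i, j) \<in> J \<times> J. A i \<inter> A j = {}}. p ^ card (case x of (i, j) \<Rightarrow> A i \<union> A j)) =
        (\<Sum>(i, j)\<in>{(i, j) \<in> J \<times> J. A i \<inter> A j = {}}. p ^ card (A i) * p ^ card (A j))"
    proof (intro sum.cong refl, clarsimp)
      fix i j assume "i \<in> J" "j \<in> J" "A i \<inter> A j = {}"
      then show "p ^ card (A i \<union> A j) = p ^ card (A i) * p ^ card (A j)"
        using assms(1,3) by (subst card_Un_disjoint) (auto simp: power_add intro: finite_subset)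
    qed
    also have "\<dots> \<le> (\<Sum>(i, j)\<in>J \<times> J. p ^ card (A i) * p ^ card (A j))"
      using assms by (intro sum_mono2) auto
    finally show "(\<Sum>x\<in>{(i, j) \<in> J \<times> J. A i \<inter> A j = {}}. p ^ card (case x of (i, j) \<Rightarrow> A i \<union> A j)) \<le> \<dots>" .
  qed
  also have "(\<Sum>(i, j)\<in>J \<times> J. p ^ card (A i) * p ^ card (A j)) = \<mu>\<^sup>2"
    unfolding \<mu> power2_eq_square by (simp add: sum_product sum.cartesian_product)
  finally have var: "measure_pmf.variance ?M ?f \<le> \<Delta>"
    by (subst measure_pmf.variance_eq) (auto simp: int E)
  have "measure_pmf.prob ?M {X. ?f X \<le> \<mu> / 2} \<le> measure_pmf.prob ?M {X. \<bar>?f X - \<mu>\<bar> \<ge> \<mu> / 2}"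
    using \<mu>(2) by (intro measure_pmf.finite_measure_mono) auto
  also have "\<dots> \<le> measure_pmf.variance ?M ?f / (\<mu> / 2)\<^sup>2"
    using measure_pmf.Chebyshev_inequality[of ?f ?M "\<mu> / 2"] \<mu>(2) E by (simp add: int)
  also have "\<dots> \<le> \<Delta> / (\<mu> / 2)\<^sup>2"
    using var \<mu>(2) by (intro divide_right_mono) auto
  finally show ?thesis by (simp add: power_divide field_simps)
qed

section \<open>Exploration of stuck sets\<close>

text \<open>
  A list records the edges found so far. Round \<open>j\<close> picks a \<open>(k - 1)\<close>-subset \<open>S\<close> of the \<open>j\<close>-th
  edge and \<open>t\<close> times either does nothing or adds a triple one of whose edges contains \<open>S\<close>. Weighting
  a list of length \<open>l\<close> by \<open>(\<lambda> p)\<^sup>l\<close> with \<open>\<lambda> > 1\<close> makes the total weight control the lists that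
  are longer than the number of rounds.
\<close>

definition triples :: "nat \<Rightarrow> nat \<Rightarrow> nat set set set" where
  "triples n k = {T. T \<subseteq> nsets {..<n} k \<and> triple k T}"

text \<open>The order of the new entries is immaterial, but it must be a function of
  \<open>L\<close> and \<open>T\<close>: then the number of possible extensions of \<open>L\<close>
  is at most the number of triples.\<close>

definition append_new :: "'a list \<Rightarrow> 'a set \<Rightarrow> 'a list" where
  "append_new L T = L @ (SOME xs. set xs = T - set L \<and> distinct xs)"

definition substep :: "nat \<Rightarrow> nat \<Rightarrow> nat set \<Rightarrow> nat set list \<Rightarrow> nat set list set" where
  "substep n k S L = insert L (append_new L ` {T \<in> triples n k. \<exists>f\<in>T. S \<subseteq> f})"

primrec substeps :: "nat \<Rightarrow> nat \<Rightarrow> nat set \<Rightarrow> nat \<Rightarrow> nat set list \<Rightarrow> nat set list set" where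
  "substeps n k S 0 L = {L}"
| "substeps n k S (Suc i) L = (\<Union>L'\<in>substep n k S L. substeps n k S i L')"

text \<open>A round past the end of the list leaves it unchanged, so a fixed number of rounds can be
  run on every list, and a list no longer than that number has had all its entries
  processed.\<close>

definition round_at :: "nat \<Rightarrow> nat \<Rightarrow> nat \<Rightarrow> nat \<Rightarrow> nat set list \<Rightarrow> nat set list set" where
  "round_at n k t j L =
     (if j < length L then \<Union>S\<in>nsets (L ! j) (k - 1). substeps n k S t L else {L})"

primrec explore :: "nat \<Rightarrow> nat \<Rightarrow> nat \<Rightarrow> nat \<Rightarrow> nat set list set" where
  "explore n k t 0 = append_new [] ` triples n k"
| "explore n k t (Suc j) = (\<Union>L\<in>explore n k t j. round_at n k t j L)"

definition edge_list :: "nat \<Rightarrow> nat \<Rightarrow> nat set list \<Rightarrow> bool" where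
  "edge_list n k L \<longleftrightarrow> distinct L \<and> set L \<subseteq> nsets {..<n} k"

definition weight :: "real \<Rightarrow> 'a list set \<Rightarrow> real" where
  "weight x R = (\<Sum>L\<in>R. x ^ length L)"

section \<open>Bookkeeping for the explored lists: distinctness, lengths, finiteness\<close>

lemma append_new:
  assumes "finite T"
  shows "\<exists>N. append_new L T = L @ N \<and> set N = T - set L \<and> distinct N"
proof -
  have "\<exists>xs. set xs = T - set L \<and> distinct xs"
    using finite_distinct_list[of "T - set L"] assms by auto
  then have "set (SOME xs. set xs = T - set L \<and> distinct xs) = T - set L \<and>
      distinct (SOME xs. set xs = T - set L \<and> distinct xs)" by (rule someI_ex)
  then show ?thesis unfolding append_new_def by blast
qed

lemma set_append_new:
  assumes "finite T"
  shows "set (append_new L T) = set L \<union> T"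
proof -
  obtain N where "append_new L T = L @ N" "set N = T - set L" using append_new[OF assms] by blast
  then show ?thesis by simp
qed

lemma length_append_new:
  assumes "finite T"
  shows "length (append_new L T) = length L + card (T - set L)"
proof -
  obtain N where "append_new L T = L @ N" "set N = T - set L" "distinct N"
    using append_new[OF assms] by blast
  then show ?thesis using distinct_card[of N] by simp
qed

lemma finite_triples: "finite (triples n k)"
  by (rule finite_subset[of _ "Pow (nsets {..<n} k)"])
     (auto simp: triples_def finite_imp_finite_nsets)

lemma triplesD:
  assumes "T \<in> triples n k"
  shows "finite T" "card T = 3" "T \<subseteq> nsets {..<n} k" "triple k T"
  using assms card_ge_0_finite[of T] by (auto simp: triples_def triple_def)

lemma finite_substep: "finite (substep n k S L)"
  by (simp add: substep_def finite_triples)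

lemma finite_substeps: "finite (substeps n k S i L)"
  by (induction i arbitrary: L) (auto simp: finite_substep)

lemma edge_list_nth: "edge_list n k L \<Longrightarrow> j < length L \<Longrightarrow> L ! j \<in> nsets {..<n} k"
  using nth_mem[of j L] by (auto simp: edge_list_def)

lemma finite_round_at:
  assumes "edge_list n k L"
  shows "finite (round_at n k t j L)"
proof (cases "j < length L")
  case True
  then have "finite (L ! j)" using edge_list_nth[OF assms True] by (simp add: nsets_def)
  then show ?thesis by (simp add: round_at_def finite_substeps finite_imp_finite_nsets)
qed (simp add: round_at_def)

lemma substep_edge_list:
  assumes "L' \<in> substep n k S L" "edge_list n k L"
  shows "edge_list n k L' \<and> length L' \<le> length L + 3"
proof (cases "L' = L")
  case False
  then obtain T where T: "T \<in> triples n k" "L' = append_new L T"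
    using assms by (auto simp: substep_def)
  obtain N where N: "append_new L T = L @ N" "set N = T - set L" "distinct N"
    using append_new triplesD(1)[OF T(1)] by blast
  have "card (T - set L) \<le> 3" using triplesD(1,2)[OF T(1)] card_mono[of T "T - set L"] by auto
  then have "length N \<le> 3" using N by (metis distinct_card)
  then show ?thesis using T N assms(2) triplesD[OF T(1)] by (auto simp: edge_list_def)
qed (use assms in auto)

lemma substeps_edge_list:
  assumes "L' \<in> substeps n k S i L" "edge_list n k L"
  shows "edge_list n k L' \<and> length L' \<le> length L + 3 * i"
  using assms
proof (induction i arbitrary: L)
  case (Suc i)
  then obtain L1 where "L1 \<in> substep n k S L" "L' \<in> substeps n k S i L1" by auto
  then show ?case using Suc.IH[of L1] substep_edge_list[of L1 n k S L] Suc.prems by fastforce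
qed auto

lemma round_at_edge_list:
  assumes "L' \<in> round_at n k t j L" "edge_list n k L"
  shows "edge_list n k L' \<and> length L' \<le> length L + 3 * t"
  using assms substeps_edge_list[of L' n k _ t L] by (auto simp: round_at_def split: if_splits)

lemma explore_edge_list:
  assumes "L \<in> explore n k t j"
  shows "edge_list n k L \<and> length L \<le> 3 + 3 * t * j"
  using assms
proof (induction j arbitrary: L)
  case 0
  then obtain T where T: "T \<in> triples n k" "L = append_new [] T" by auto
  then show ?case using append_new[of T "[]"] triplesD[OF T(1)]
    by (auto simp: edge_list_def distinct_card[symmetric])
next
  case (Suc j)
  then obtain L1 where L1: "L1 \<in> explore n k t j" "L \<in> round_at n k t j L1" by auto
  then show ?case using Suc.IH[OF L1(1)] round_at_edge_list[OF L1(2)]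
    by (auto simp: algebra_simps)
qed

lemma finite_explore: "finite (explore n k t j)"
proof (induction j)
  case (Suc j)
  then show ?case
    unfolding explore.simps
    by (intro finite_UN_I finite_round_at) (auto dest: explore_edge_list)
qed (simp add: finite_triples)

section \<open>Counting triples and bounding the weight of the exploration\<close>

lemma weight_UN_le:
  assumes "finite R" "\<And>L. L \<in> R \<Longrightarrow> finite (f L)" "0 \<le> x"
  shows "weight x (\<Union>L\<in>R. f L) \<le> (\<Sum>L\<in>R. weight x (f L))"
  using assms
proof (induction R rule: finite_induct)
  case (insert a R)
  have "weight x (f a \<union> (\<Union>L\<in>R. f L)) \<le> weight x (f a) + weight x (\<Union>L\<in>R. f L)"
    unfolding weight_def using insert by (subst sum_Un) (auto intro!: sum_nonneg)
  then show ?case using insert by fastforce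
qed (simp add: weight_def)

text \<open>The number of set families on \<open>2 * k + 2\<close> points, a crude bound for the
  triples on a given vertex set. That size has room for the union of two arbitrary edges, and for
  \<open>S\<close> or an edge with one or two added vertices.\<close>

definition triple_bound :: "nat \<Rightarrow> nat" where
  "triple_bound k = 2 ^ 2 ^ (2 * k + 2)"

lemma card_le_triple_bound:
  assumes "\<T> \<subseteq> (\<Union>i\<in>J. Pow (Pow (g i)))" "finite J"
    and "\<And>i. i \<in> J \<Longrightarrow> finite (g i) \<and> card (g i) \<le> 2 * k + 2"
  shows "card \<T> \<le> card J * triple_bound k"
proof -
  have "card \<T> \<le> card (\<Union>i\<in>J. Pow (Pow (g i)))"
    using assms by (intro card_mono) auto
  also have "\<dots> \<le> (\<Sum>i\<in>J. card (Pow (Pow (g i))))"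
    using assms(2) by (rule card_UN_le)
  also have "\<dots> \<le> (\<Sum>i\<in>J. triple_bound k)"
    using assms(3) unfolding triple_bound_def
    by (intro sum_mono) (simp add: card_Pow power_increasing del: power_Suc add_2_eq_Suc')
  finally show ?thesis by simp
qed

lemma triple_Union_insert:
  assumes "triple k T" "e \<in> T"
  shows "\<exists>y. \<Union>T = insert y e"
proof -
  have fin: "finite (\<Union>T)" using assms unfolding triple_def by (auto intro: card_ge_0_finite)
  have "card (\<Union>T - e) = 1"
    using assms fin by (subst card_Diff_subset) (auto simp: triple_def)
  then obtain y where "\<Union>T - e = {y}" by (auto simp: card_1_singleton_iff)
  then show ?thesis using assms by blast
qed

text \<open>Two distinct \<open>k\<close>-sets inside a set of \<open>k + 1\<close> vertices cover
  it; hence two known edges already determine the vertex set of a triple.\<close>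

lemma triple_Union_Un:
  assumes "triple k T" "e \<in> T" "f \<in> T" "e \<noteq> f"
  shows "\<Union>T = e \<union> f"
proof -
  obtain y where y: "\<Union>T = insert y e" using triple_Union_insert assms by blast
  have "finite e" "card e = card f" "finite f" using assms by (auto simp: triple_def)
  then have "\<not> f \<subseteq> e" using assms(4) card_subset_eq by metis
  moreover have "f \<subseteq> insert y e" using y assms by blast
  ultimately show ?thesis unfolding y by blast
qed

lemma binomial_le_power: "n choose k \<le> n ^ k"
  by (cases "k \<le> n") (auto simp: not_le binomial_eq_0 intro: binomial_le_pow)

lemma card_nsets_eq: "finite A \<Longrightarrow> card (nsets A k) = card A choose k"
  using n_subsets[of A k] by (simp add: nsets_def finite_subset conj_commute cong: conj_cong)

lemma card_triples_le: "card (triples n k) \<le> n ^ Suc k * triple_bound k"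
proof -
  have "card (triples n k) \<le> card (nsets {..<n} (Suc k)) * triple_bound k"
  proof (rule card_le_triple_bound)
    show "triples n k \<subseteq> (\<Union>W\<in>nsets {..<n} (Suc k). Pow (Pow W))"
    proof
      fix T assume T: "T \<in> triples n k"
      then have "\<Union>T \<in> nsets {..<n} (Suc k)"
        unfolding triples_def triple_def nsets_def by (auto intro: card_ge_0_finite)
      then show "T \<in> (\<Union>W\<in>nsets {..<n} (Suc k). Pow (Pow W))" by blast
    qed
  qed (auto simp: nsets_def finite_imp_finite_nsets)
  also have "card (nsets {..<n} (Suc k)) \<le> n ^ Suc k"
    using binomial_le_power[of n "Suc k"] by (simp add: card_nsets_eq)
  finally show ?thesis by simp
qed

text \<open>A triple containing an edge over \<open>S\<close> has at most \<open>n\<^sup>2\<close>, \<open>l n\<close> or \<open>l\<^sup>2\<close> possible vertex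
  sets according to whether it has \<open>0\<close>, \<open>1\<close> or \<open>2\<close> edges in \<open>L\<close>.\<close>

lemma weight_substep_le:
  fixes x :: real
  assumes L: "edge_list n k L" "length L \<le> l" and S: "card S = k - 1" "finite S"
    and x: "0 \<le> x" and k: "1 \<le> k"
  shows "weight x (substep n k S L) \<le>
    x ^ length L * (1 + triple_bound k * (real n ^ 2 * x ^ 3 + l * n * x ^ 2 + l ^ 2 * x))"
proof -
  let ?K = "triple_bound k"
  define \<T> where "\<T> i = {T \<in> triples n k. (\<exists>f\<in>T. S \<subseteq> f) \<and> card (T - set L) = i}" for i
  have fin: "finite (\<T> i)" for i by (simp add: \<T>_def finite_triples)
  have cL: "card (set L) \<le> l" using L card_length[of L] by linarith
  have Lk: "finite e \<and> card e = k" if "e \<in> set L" for e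
    using L that by (auto simp: edge_list_def nsets_def)
  \<comment> \<open>A triple without new edges returns \<open>L\<close> itself, which the inserted
    \<open>L\<close> already accounts for. So only one, two or three new edges have to be
    counted.\<close>
  have sub: "substep n k S L \<subseteq> insert L (append_new L ` (\<T> 1 \<union> \<T> 2 \<union> \<T> 3))"
  proof
    fix L' assume L': "L' \<in> substep n k S L"
    show "L' \<in> insert L (append_new L ` (\<T> 1 \<union> \<T> 2 \<union> \<T> 3))"
    proof (cases "L' = L")
      case False
      then obtain T where T: "T \<in> triples n k" "\<exists>f\<in>T. S \<subseteq> f" "L' = append_new L T"
        using L' by (auto simp: substep_def)
      have "card (T - set L) \<le> 3" using triplesD(1,2)[OF T(1)] card_mono[of T "T - set L"] by auto
      moreover have "card (T - set L) \<noteq> 0"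
        using append_new[OF triplesD(1)[OF T(1)], of L] T(3) False triplesD(1)[OF T(1)]
        by (metis append_Nil2 card_0_eq finite_Diff set_empty)
      ultimately have "card (T - set L) \<in> {1, 2, 3}" by auto
      then show ?thesis using T by (auto simp: \<T>_def)
    qed simp
  qed
  have c3: "card (\<T> 3) \<le> card ({..<n} \<times> {..<n}) * ?K"
  proof (rule card_le_triple_bound)
    show "\<T> 3 \<subseteq> (\<Union>z\<in>{..<n} \<times> {..<n}. Pow (Pow (S \<union> {fst z, snd z})))"
    proof
      fix T assume "T \<in> \<T> 3"
      then obtain f where f: "T \<in> triples n k" "f \<in> T" "S \<subseteq> f" by (auto simp: \<T>_def)
      note T = triplesD[OF f(1)]
      obtain y where y: "\<Union>T = insert y f" using triple_Union_insert T f by blast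
      have "card (f - S) = 1"
        using T(4) f S k by (subst card_Diff_subset) (auto simp: triple_def)
      then obtain x where x: "f - S = {x}" by (auto simp: card_1_singleton_iff)
      have lt: "\<Union>T \<subseteq> {..<n}" using T(3) by (auto simp: nsets_def)
      have "y < n" "x < n" using y x f lt by auto
      have "\<Union>T = S \<union> {x, y}" using y x f by blast
      then have "T \<in> Pow (Pow (S \<union> {x, y}))" by blast
      with \<open>y < n\<close> \<open>x < n\<close>
      show "T \<in> (\<Union>z\<in>{..<n} \<times> {..<n}. Pow (Pow (S \<union> {fst z, snd z})))"
        by (intro UN_I[of "(x, y)"]) simp_all
    qed
  next
    fix z show "finite (S \<union> {fst z, snd z}) \<and> card (S \<union> {fst z, snd z}) \<le> 2 * k + 2"
      using S card_Un_le[of S "{fst z, snd z}"] card_insert_le_m1[of 2 "{snd z}" "fst z"] by auto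
  qed auto
  have c2: "card (\<T> 2) \<le> card (set L \<times> {..<n}) * ?K"
  proof (rule card_le_triple_bound)
    show "\<T> 2 \<subseteq> (\<Union>z\<in>set L \<times> {..<n}. Pow (Pow (insert (snd z) (fst z))))"
    proof
      fix T assume "T \<in> \<T> 2"
      then have f: "T \<in> triples n k" "card (T - set L) = 2" by (auto simp: \<T>_def)
      note T = triplesD[OF f(1)]
      have "\<not> T \<inter> set L = {}" using f T by (auto simp: Diff_triv)
      then obtain e where e: "e \<in> T" "e \<in> set L" by blast
      obtain y where y: "\<Union>T = insert y e" using triple_Union_insert T e by blast
      have "y < n" using y T(3) by (auto simp: nsets_def)
      moreover have "T \<in> Pow (Pow (insert y e))" using y by blast
      ultimately show "T \<in> (\<Union>z\<in>set L \<times> {..<n}. Pow (Pow (insert (snd z) (fst z))))"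
        using e by (intro UN_I[of "(e, y)"]) simp_all
    qed
  next
    fix z assume "z \<in> set L \<times> {..<n}"
    then show "finite (insert (snd z) (fst z)) \<and> card (insert (snd z) (fst z)) \<le> 2 * k + 2"
      using Lk[of "fst z"] card_insert_le_m1[of "Suc k" "fst z" "snd z"] by auto
  qed auto
  have c1: "card (\<T> 1) \<le> card (set L \<times> set L) * ?K"
  proof (rule card_le_triple_bound)
    show "\<T> 1 \<subseteq> (\<Union>z\<in>set L \<times> set L. Pow (Pow (fst z \<union> snd z)))"
    proof
      fix T assume "T \<in> \<T> 1"
      then have f: "T \<in> triples n k" "card (T - set L) = 1" by (auto simp: \<T>_def)
      note T = triplesD[OF f(1)]
      have "card (T \<inter> set L) = 2" using f T card_Int_Diff[of T "set L"] by simp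
      then obtain e e' where e: "e \<in> T" "e \<in> set L" "e' \<in> T" "e' \<in> set L" "e \<noteq> e'"
        by (auto simp: card_2_iff)
      have "\<Union>T = e \<union> e'" using triple_Union_Un T e by blast
      then have "T \<in> Pow (Pow (e \<union> e'))" by blast
      then show "T \<in> (\<Union>z\<in>set L \<times> set L. Pow (Pow (fst z \<union> snd z)))"
        using e by (intro UN_I[of "(e, e')"]) simp_all
    qed
  next
    fix z assume "z \<in> set L \<times> set L"
    then show "finite (fst z \<union> snd z) \<and> card (fst z \<union> snd z) \<le> 2 * k + 2"
      using Lk[of "fst z"] Lk[of "snd z"] card_Un_le[of "fst z" "snd z"] by auto
  qed auto
  have part: "(\<Sum>T\<in>\<T> i. x ^ length (append_new L T)) = x ^ length L * (card (\<T> i) * x ^ i)" for i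
  proof -
    have "(\<Sum>T\<in>\<T> i. x ^ length (append_new L T)) = (\<Sum>T\<in>\<T> i. x ^ (length L + i))"
      by (intro sum.cong refl) (auto simp: \<T>_def length_append_new triplesD(1))
    then show ?thesis by (simp add: power_add)
  qed
  have "card (\<T> 3) \<le> n ^ 2 * ?K" using c3 by (simp add: power2_eq_square)
  then have t3: "real (card (\<T> 3)) \<le> real n ^ 2 * ?K"
    by (metis of_nat_le_iff of_nat_mult of_nat_power)
  have "card (\<T> 2) \<le> l * n * ?K"
    using c2 cL by (auto simp: card_cartesian_product intro: order_trans mult_le_mono)
  then have t2: "real (card (\<T> 2)) \<le> real l * n * ?K"
    by (metis of_nat_le_iff of_nat_mult)
  have "card (\<T> 1) \<le> l * l * ?K"
    using c1 cL by (auto simp: card_cartesian_product intro: order_trans mult_le_mono)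
  then have t1: "real (card (\<T> 1)) \<le> real l ^ 2 * ?K"
    by (metis of_nat_le_iff of_nat_mult power2_eq_square)
  have "weight x (substep n k S L) \<le> weight x (insert L (append_new L ` (\<T> 1 \<union> \<T> 2 \<union> \<T> 3)))"
    unfolding weight_def using sub x fin by (intro sum_mono2) auto
  also have "\<dots> \<le> x ^ length L + weight x (append_new L ` (\<T> 1 \<union> \<T> 2 \<union> \<T> 3))"
    unfolding weight_def using fin x by (simp add: sum.insert_if)
  also have "weight x (append_new L ` (\<T> 1 \<union> \<T> 2 \<union> \<T> 3)) \<le>
      (\<Sum>T\<in>\<T> 1 \<union> \<T> 2 \<union> \<T> 3. x ^ length (append_new L T))"
    unfolding weight_def using fin x sum_image_le[of _ "\<lambda>L. x ^ length L" "append_new L"] by (simp add: o_def)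
  also have "\<dots> = (\<Sum>T\<in>\<T> 1. x ^ length (append_new L T)) + (\<Sum>T\<in>\<T> 2. x ^ length (append_new L T))
      + (\<Sum>T\<in>\<T> 3. x ^ length (append_new L T))"
    using fin by (subst sum.union_disjoint, (auto simp: \<T>_def)[3])+ simp
  also have "\<dots> = x ^ length L * (card (\<T> 1) * x + card (\<T> 2) * x ^ 2 + card (\<T> 3) * x ^ 3)"
    unfolding part by (simp add: algebra_simps)
  also have "\<dots> \<le> x ^ length L * ((real l ^ 2 * ?K) * x + (real l * n * ?K) * x ^ 2 + (real n ^ 2 * ?K) * x ^ 3)"
    using t1 t2 t3 x by (intro mult_left_mono add_mono mult_right_mono) auto
  finally show ?thesis by (simp add: algebra_simps)
qed

text \<open>Growth of the weight in one substep. For \<open>x\<close> of order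
  \<open>n powr (- 2 / 3)\<close> the term with \<open>x ^ 3\<close> is of constant order, while the
  other two are of order \<open>l * n powr (- 1 / 3)\<close> and its square, negligible for lists
  much shorter than \<open>n powr (1 / 3)\<close>.\<close>

definition substep_factor :: "nat \<Rightarrow> nat \<Rightarrow> nat \<Rightarrow> real \<Rightarrow> real" where
  "substep_factor n k l x =
     1 + triple_bound k * (real n ^ 2 * x ^ 3 + l * n * x ^ 2 + l ^ 2 * x)"

lemma substep_factor_ge_1: "0 \<le> x \<Longrightarrow> 1 \<le> substep_factor n k l x"
  by (simp add: substep_factor_def)

lemma weight_substeps_le:
  fixes x :: real
  assumes "edge_list n k L" "length L + 3 * i \<le> l" and S: "card S = k - 1" "finite S"
    and x: "0 \<le> x" and k: "1 \<le> k"
  shows "weight x (substeps n k S i L) \<le> x ^ length L * substep_factor n k l x ^ i"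
  using assms(1,2)
proof (induction i arbitrary: L)
  case 0
  then show ?case by (simp add: weight_def)
next
  case (Suc i)
  let ?\<rho> = "substep_factor n k l x"
  have \<rho>: "0 \<le> ?\<rho> ^ i" using substep_factor_ge_1[OF x, of n k l] by simp
  have "weight x (substeps n k S (Suc i) L) \<le> (\<Sum>L'\<in>substep n k S L. weight x (substeps n k S i L'))"
    unfolding substeps.simps by (intro weight_UN_le finite_substep finite_substeps x)
  also have "\<dots> \<le> (\<Sum>L'\<in>substep n k S L. x ^ length L' * ?\<rho> ^ i)"
  proof (intro sum_mono)
    fix L' assume "L' \<in> substep n k S L"
    from substep_edge_list[OF this Suc.prems(1)] Suc.prems(2)
    show "weight x (substeps n k S i L') \<le> x ^ length L' * ?\<rho> ^ i"
      by (intro Suc.IH) auto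
  qed
  also have "\<dots> = weight x (substep n k S L) * ?\<rho> ^ i"
    by (simp add: weight_def sum_distrib_right)
  also have "\<dots> \<le> (x ^ length L * ?\<rho>) * ?\<rho> ^ i"
    using weight_substep_le[OF Suc.prems(1) _ S x k, of l] Suc.prems(2) \<rho>
    by (intro mult_right_mono) (auto simp: substep_factor_def)
  finally show ?case by (simp add: mult.assoc)
qed

text \<open>The factor \<open>k\<close> counts the choices of \<open>S\<close> inside the processed
  edge. For an idle round the estimate holds because the whole factor is at least 1.\<close>

lemma weight_round_at_le:
  fixes x :: real
  assumes L: "edge_list n k L" "length L + 3 * t \<le> l" and x: "0 \<le> x" and k: "1 \<le> k"
  shows "weight x (round_at n k t j L) \<le> x ^ length L * (k * substep_factor n k l x ^ t)"
proof (cases "j < length L")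
  case True
  let ?\<rho> = "substep_factor n k l x"
  have e: "finite (L ! j)" "card (L ! j) = k"
    using edge_list_nth[OF L(1) True] by (auto simp: nsets_def)
  have fin: "finite (nsets (L ! j) (k - 1))" using e by (simp add: finite_imp_finite_nsets)
  have "card (nsets (L ! j) (k - 1)) = k choose (k - 1)" using e by (simp add: card_nsets_eq)
  also have "\<dots> = k" using k binomial_symmetric[of "k - 1" k] by simp
  finally have card: "card (nsets (L ! j) (k - 1)) = k" .
  have "weight x (round_at n k t j L) \<le> (\<Sum>S\<in>nsets (L ! j) (k - 1). weight x (substeps n k S t L))"
    using True fin by (auto simp: round_at_def intro!: weight_UN_le finite_substeps x)
  also have "\<dots> \<le> (\<Sum>S\<in>nsets (L ! j) (k - 1). x ^ length L * ?\<rho> ^ t)"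
    using L x k by (intro sum_mono weight_substeps_le) (auto simp: nsets_def)
  finally show ?thesis unfolding sum_constant card by (simp add: algebra_simps)
next
  case False
  have "1 \<le> k * substep_factor n k l x ^ t"
    using k substep_factor_ge_1[OF x, of n k l]
    by (metis mult_mono' mult_1 of_nat_1 of_nat_le_iff one_le_power zero_le_one)
  then have "x ^ length L * 1 \<le> x ^ length L * (k * substep_factor n k l x ^ t)"
    using x by (intro mult_left_mono) auto
  then show ?thesis using False by (simp add: round_at_def weight_def)
qed

text \<open>The weight of the starting triples is multiplied by the same factor in every round,
  since \<open>3 + 3 * t * j\<close> bounds the length of every list that occurs up to round
  \<open>j\<close>.\<close>

lemma weight_explore_le:
  fixes x :: real
  assumes "3 + 3 * t * j \<le> l" and x: "0 \<le> x" and k: "1 \<le> k"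
  shows "weight x (explore n k t j) \<le>
    n ^ Suc k * triple_bound k * x ^ 3 * (k * substep_factor n k l x ^ t) ^ j"
  using assms(1)
proof (induction j)
  case 0
  have "weight x (explore n k t 0) \<le> (\<Sum>T\<in>triples n k. x ^ length (append_new [] T))"
    unfolding weight_def
    using sum_image_le[of "triples n k" "\<lambda>L. x ^ length L" "append_new []"] finite_triples[of n k] x
    by (simp add: o_def)
  also have "\<dots> = (\<Sum>T\<in>triples n k. x ^ 3)"
    by (intro sum.cong refl) (auto simp: length_append_new triplesD)
  also have "\<dots> = card (triples n k) * x ^ 3" by simp
  also have "\<dots> \<le> (n ^ Suc k * triple_bound k) * x ^ 3"
    using card_triples_le[of n k] x
    by (intro mult_right_mono) (simp_all only: of_nat_le_iff zero_le_power)
  finally show ?case by simp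
next
  case (Suc j)
  let ?\<kappa> = "k * substep_factor n k l x ^ t"
  have \<kappa>: "0 \<le> ?\<kappa>" using substep_factor_ge_1[OF x, of n k l] by simp
  have "weight x (explore n k t (Suc j)) \<le> (\<Sum>L\<in>explore n k t j. weight x (round_at n k t j L))"
    unfolding explore.simps
    by (intro weight_UN_le finite_explore finite_round_at x) (simp add: explore_edge_list)
  also have "\<dots> \<le> (\<Sum>L\<in>explore n k t j. x ^ length L * ?\<kappa>)"
  proof (intro sum_mono weight_round_at_le x k)
    fix L assume "L \<in> explore n k t j"
    from explore_edge_list[OF this] Suc.prems
    show "edge_list n k L" "length L + 3 * t \<le> l" by auto
  qed
  also have "\<dots> = weight x (explore n k t j) * ?\<kappa>"
    by (simp add: weight_def sum_distrib_right)
  also have "\<dots> \<le> (n ^ Suc k * triple_bound k * x ^ 3 * ?\<kappa> ^ j) * ?\<kappa>"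
    using Suc.IH Suc.prems \<kappa> by (intro mult_right_mono) auto
  finally show ?case by (simp only: power_Suc2 mult.assoc)
qed

text \<open>Spend one substep on each \<open>f\<close> in \<open>A\<close>, adding a triple of
  \<open>E\<close> that contains it. Adding whole triples preserves the invariant that each listed
  edge lies in a listed triple, and since entries are only appended, earlier positions keep their
  meaning.\<close>

lemma substeps_cover:
  assumes "finite A" "\<And>f. f \<in> A \<Longrightarrow> S \<subseteq> f \<and> (\<exists>T\<subseteq>E. f \<in> T \<and> triple k T)"
    and E: "E \<subseteq> nsets {..<n} k"
    and L: "set L \<subseteq> E" "\<And>e. e \<in> set L \<Longrightarrow> \<exists>T\<subseteq>set L. e \<in> T \<and> triple k T"
  shows "\<exists>N. L @ N \<in> substeps n k S (card A) L \<and> A \<subseteq> set (L @ N) \<and> set (L @ N) \<subseteq> E \<and>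
    (\<forall>e\<in>set (L @ N). \<exists>T\<subseteq>set (L @ N). e \<in> T \<and> triple k T)"
  using assms(1,2) L
proof (induction A arbitrary: L rule: finite_induct)
  case empty
  then show ?case by (intro exI[of _ "[]"]) (simp add: empty.prems(3))
next
  case (insert f A)
  obtain T where T: "S \<subseteq> f" "T \<subseteq> E" "f \<in> T" "triple k T"
    using insert.prems(1)[of f] by blast
  have tr: "T \<in> triples n k" using T E by (auto simp: triples_def)
  obtain N where N: "append_new L T = L @ N" "set N = T - set L"
    using append_new triplesD(1)[OF tr] by blast
  have set: "set (L @ N) = set L \<union> T" using N by auto
  have step: "L @ N \<in> substep n k S L" using tr T N(1) by (auto simp: substep_def intro!: image_eqI)
  have clo: "\<exists>T'\<subseteq>set (L @ N). e \<in> T' \<and> triple k T'" if "e \<in> set (L @ N)" for e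
  proof (cases "e \<in> set L")
    case True
    from insert.prems(3)[OF this] show ?thesis unfolding set by blast
  next
    case False
    then show ?thesis using that T(4) unfolding set by blast
  qed
  have sub: "set (L @ N) \<subseteq> E" using insert.prems(2) T unfolding set by blast
  have star: "S \<subseteq> f' \<and> (\<exists>T\<subseteq>E. f' \<in> T \<and> triple k T)" if "f' \<in> A" for f'
    using insert.prems(1)[of f'] that by blast
  have "\<exists>N'. (L @ N) @ N' \<in> substeps n k S (card A) (L @ N) \<and>
      A \<subseteq> set ((L @ N) @ N') \<and> set ((L @ N) @ N') \<subseteq> E \<and>
      (\<forall>e\<in>set ((L @ N) @ N'). \<exists>T\<subseteq>set ((L @ N) @ N'). e \<in> T \<and> triple k T)"
    by (rule insert.IH[OF star sub clo])
  then obtain N' where N': "(L @ N) @ N' \<in> substeps n k S (card A) (L @ N)"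
    "A \<subseteq> set ((L @ N) @ N')" "set ((L @ N) @ N') \<subseteq> E"
    "\<forall>e\<in>set ((L @ N) @ N'). \<exists>T\<subseteq>set ((L @ N) @ N'). e \<in> T \<and> triple k T"
    by (elim exE conjE)
  have "L @ (N @ N') \<in> substeps n k S (card (insert f A)) L"
    using N'(1) step insert.hyps by auto
  moreover have "insert f A \<subseteq> set (L @ (N @ N'))"
    using N'(2) set T(3) by auto
  ultimately show ?case using N'(3,4) by (intro exI[of _ "N @ N'"]) simp
qed

text \<open>Let \<open>E\<close> guide the choices: in round \<open>j\<close> take a heavy
  \<open>S\<close> below the \<open>j\<close>-th entry and exactly \<open>t\<close> edges of
  \<open>E\<close> over \<open>S\<close>, and reach them by the \<open>t\<close> substeps. Entries
  processed earlier stay heavy, as the list only grows.\<close>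

lemma stuck_explore:
  assumes st: "stuck k t E" and E: "E \<subseteq> nsets {..<n} k"
  shows "\<exists>L\<in>explore n k t j. L \<noteq> [] \<and> set L \<subseteq> E \<and>
    (\<forall>e\<in>set L. \<exists>T\<subseteq>set L. e \<in> T \<and> triple k T) \<and>
    (\<forall>i<min j (length L). \<exists>S\<subseteq>L ! i. card S = k - 1 \<and> t \<le> card {f \<in> set L. S \<subseteq> f})"
proof (induction j)
  case 0
  obtain e T where T: "T \<subseteq> E" "e \<in> T" "triple k T" using st unfolding stuck_def by blast
  then have tr: "T \<in> triples n k" using E by (auto simp: triples_def)
  have set: "set (append_new [] T) = T" using set_append_new[OF triplesD(1)[OF tr]] by simp
  show ?case
  proof (intro bexI[of _ "append_new [] T"] conjI)
    show "append_new [] T \<noteq> []" using set T(2) by force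
    show "\<forall>e\<in>set (append_new [] T). \<exists>T'\<subseteq>set (append_new [] T). e \<in> T' \<and> triple k T'"
      using T unfolding set by blast
  qed (use T tr set in auto)
next
  case (Suc j)
  then obtain L where L: "L \<in> explore n k t j" "L \<noteq> []" "set L \<subseteq> E"
    and clo: "\<forall>e\<in>set L. \<exists>T\<subseteq>set L. e \<in> T \<and> triple k T"
    and heavy: "\<forall>i<min j (length L). \<exists>S\<subseteq>L ! i. card S = k - 1 \<and> t \<le> card {f \<in> set L. S \<subseteq> f}"
    by blast
  show ?case
  proof (cases "j < length L")
    case False
    then have "L \<in> explore n k t (Suc j)" using L(1) by (auto simp: round_at_def)
    moreover have "min (Suc j) (length L) = min j (length L)" using False by simp
    ultimately show ?thesis using L clo heavy by (intro bexI[of _ L]) simp_all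
  next
    case True
    then have Lj: "L ! j \<in> E" using L(3) by auto
    then obtain S where S: "S \<subseteq> L ! j" "card S = k - 1" "t \<le> card {f \<in> E. S \<subseteq> f}"
      using st unfolding stuck_def by blast
    obtain A where A: "A \<subseteq> {f \<in> E. S \<subseteq> f}" "card A = t" "finite A"
      using obtain_subset_with_card_n[OF S(3)] by blast
    have "\<exists>N. L @ N \<in> substeps n k S (card A) L \<and> A \<subseteq> set (L @ N) \<and> set (L @ N) \<subseteq> E \<and>
        (\<forall>e\<in>set (L @ N). \<exists>T\<subseteq>set (L @ N). e \<in> T \<and> triple k T)"
    proof (rule substeps_cover[OF A(3) _ E L(3)])
      fix f assume "f \<in> A"
      then show "S \<subseteq> f \<and> (\<exists>T\<subseteq>E. f \<in> T \<and> triple k T)" using A(1) st unfolding stuck_def by blast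
    qed (use clo in blast)
    then obtain N where N: "L @ N \<in> substeps n k S t L" "A \<subseteq> set (L @ N)" "set (L @ N) \<subseteq> E"
      "\<forall>e\<in>set (L @ N). \<exists>T\<subseteq>set (L @ N). e \<in> T \<and> triple k T"
      unfolding A(2) by blast
    have "S \<in> nsets (L ! j) (k - 1)"
      using S Lj E by (auto simp: nsets_def intro: finite_subset)
    then have "L @ N \<in> round_at n k t j L" using True N(1) by (auto simp: round_at_def)
    then have mem: "L @ N \<in> explore n k t (Suc j)" using L(1) by auto
    have heavy': "\<exists>S\<subseteq>(L @ N) ! i. card S = k - 1 \<and> t \<le> card {f \<in> set (L @ N). S \<subseteq> f}"
      if i: "i < min (Suc j) (length (L @ N))" for i
    proof (cases "i = j")
      case True
      have "t \<le> card {f \<in> set (L @ N). S \<subseteq> f}"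
        unfolding A(2)[symmetric] using A(1) N(2) by (intro card_mono) auto
      then show ?thesis using S True \<open>j < length L\<close> by (auto simp: nth_append)
    next
      case False
      then have "i < min j (length L)" using i True by simp
      then obtain S' where S': "S' \<subseteq> L ! i" "card S' = k - 1" "t \<le> card {f \<in> set L. S' \<subseteq> f}"
        using heavy by blast
      have "card {f \<in> set L. S' \<subseteq> f} \<le> card {f \<in> set (L @ N). S' \<subseteq> f}"
        by (intro card_mono) auto
      then show ?thesis using S' \<open>i < min j (length L)\<close>
        by (intro exI[of _ S']) (auto simp: nth_append)
    qed
    show ?thesis using mem L(2) N(3,4) heavy' by (intro bexI[of _ "L @ N"]) auto
  qed
qed

text \<open>If the list has at most \<open>M\<close> entries after \<open>M\<close> rounds, all of
  them have been processed, so the list is closed under both conditions and its set of entries is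
  itself a stuck set.\<close>

lemma stuck_imp_small_or_long:
  assumes st: "stuck k t E" and E: "E \<subseteq> nsets {..<n} k"
  shows "(\<exists>E'\<subseteq>E. stuck k t E' \<and> card E' \<le> M) \<or> (\<exists>L\<in>explore n k t M. M < length L \<and> set L \<subseteq> E)"
proof -
  obtain L where L: "L \<in> explore n k t M" "L \<noteq> []" "set L \<subseteq> E"
    and clo: "\<forall>e\<in>set L. \<exists>T\<subseteq>set L. e \<in> T \<and> triple k T"
    and heavy: "\<forall>i<min M (length L). \<exists>S\<subseteq>L ! i. card S = k - 1 \<and> t \<le> card {f \<in> set L. S \<subseteq> f}"
    using stuck_explore[OF assms, of M] by blast
  show ?thesis
  proof (cases "M < length L")
    case False
    then have min: "min M (length L) = length L" by simp
    have "stuck k t (set L)"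
        unfolding stuck_def
    proof (intro conjI ballI)
      fix e assume e: "e \<in> set L"
      show "\<exists>T\<subseteq>set L. e \<in> T \<and> triple k T" using clo e by blast
      obtain i where "i < length L" "e = L ! i" using e by (auto simp: in_set_conv_nth)
      then show "\<exists>S\<subseteq>e. card S = k - 1 \<and> t \<le> card {f \<in> set L. S \<subseteq> f}"
        using heavy[unfolded min] by blast
    qed (use L(2) in simp)
    moreover have "card (set L) \<le> M" using False card_length[of L] by linarith
    ultimately show ?thesis using L(3) by blast
  qed (use L in blast)
qed

section \<open>Absence of stuck sets\<close>

lemma powr_power_real: "0 < x \<Longrightarrow> (x powr a) ^ m = x powr (a * real m)" for x :: real
  by (simp add: powr_realpow[symmetric] powr_powr)

definition dense_sets :: "nat \<Rightarrow> nat \<Rightarrow> nat \<Rightarrow> nat set set set" where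
  "dense_sets n k s = {E. E \<subseteq> nsets {..<n} k \<and> card E = s \<and> 12 * card (\<Union>E) \<le> 7 * s}"

lemma finite_dense_sets: "finite (dense_sets n k s)"
  by (rule finite_subset[of _ "Pow (nsets {..<n} k)"])
     (auto simp: dense_sets_def finite_imp_finite_nsets)

text \<open>First choose a list of \<open>7 * s div 12\<close> vertices that covers the edges. It
  has at most \<open>s\<close> distinct entries, so at most \<open>s ^ k\<close> edges are
  available, and \<open>s\<close> of them are chosen.\<close>

lemma card_dense_sets_le:
  assumes "1 \<le> s" "1 \<le> k"
  shows "card (dense_sets n k s) \<le> n ^ (7 * s div 12) * (s ^ k) ^ s"
proof -
  let ?v = "7 * s div 12"
  let ?B = "{xs. set xs \<subseteq> {..<n} \<and> length xs = ?v}"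
  have "dense_sets n k s \<subseteq> (\<Union>xs\<in>?B. {E. E \<subseteq> nsets (set xs) k \<and> card E = s})"
  proof
    fix E assume "E \<in> dense_sets n k s"
    then have E: "E \<subseteq> nsets {..<n} k" "card E = s" "card (\<Union>E) \<le> ?v"
      by (auto simp: dense_sets_def)
    have "\<Union>E \<subseteq> {..<n}" using E(1) by (auto simp: nsets_def)
    then obtain ys where ys: "set ys = \<Union>E" "distinct ys"
      using finite_distinct_list finite_subset by (metis finite_lessThan)
    obtain e where "e \<in> E" using E(2) assms(1) by force
    then have "e \<noteq> {}" using E(1) assms(2) by (auto simp: nsets_def)
    then obtain x where x: "x \<in> \<Union>E" using \<open>e \<in> E\<close> by blast
    \<comment> \<open>Repeating a vertex pads the list to the exact length \<open>?v\<close>, so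
      that one family of lists handles all smaller vertex sets too.\<close>
    let ?xs = "ys @ replicate (?v - length ys) x"
    have "length ys \<le> ?v" using E(3) ys distinct_card[of ys] by simp
    moreover have set: "set ?xs = \<Union>E" using ys x by auto
    ultimately have "?xs \<in> ?B" using \<open>\<Union>E \<subseteq> {..<n}\<close> by auto
    moreover have "E \<subseteq> nsets (set ?xs) k" unfolding set using E(1) by (auto simp: nsets_def)
    ultimately show "E \<in> (\<Union>xs\<in>?B. {E. E \<subseteq> nsets (set xs) k \<and> card E = s})" using E(2) by blast
  qed
  then have "card (dense_sets n k s) \<le> card (\<Union>xs\<in>?B. {E. E \<subseteq> nsets (set xs) k \<and> card E = s})"
    by (intro card_mono finite_UN_I finite_lists_length_eq)
       (auto simp: finite_imp_finite_nsets intro: finite_subset[of _ "Pow (nsets (set _) k)"])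
  also have "\<dots> \<le> (\<Sum>xs\<in>?B. card {E. E \<subseteq> nsets (set xs) k \<and> card E = s})"
    by (intro card_UN_le finite_lists_length_eq) simp
  also have "\<dots> \<le> (\<Sum>xs\<in>?B. (s ^ k) ^ s)"
  proof (intro sum_mono)
    fix xs assume xs: "xs \<in> ?B"
    have "card (set xs) \<le> s" using xs card_length[of xs] by auto
    then have "card (nsets (set xs) k) \<le> s ^ k"
      using binomial_le_power[of "card (set xs)" k] power_mono[of "card (set xs)" s k]
      by (simp add: card_nsets_eq)
    then have "card (nsets (set xs) k) ^ s \<le> (s ^ k) ^ s" by (rule power_mono) simp
    moreover have "card {E. E \<subseteq> nsets (set xs) k \<and> card E = s} = card (nsets (set xs) k) choose s"
      by (rule n_subsets) (simp add: finite_imp_finite_nsets)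
    ultimately show "card {E. E \<subseteq> nsets (set xs) k \<and> card E = s} \<le> (s ^ k) ^ s"
      using binomial_le_power[of "card (nsets (set xs) k)" s] by linarith
  qed
  also have "\<dots> = n ^ ?v * (s ^ k) ^ s"
    using card_lists_length_eq[of "{..<n}" ?v] by simp
  finally show ?thesis .
qed

text \<open>For each \<open>s\<close> the powers of \<open>n\<close> combine to 7/12 - 2/3 = -1/12
  per edge. The sum over \<open>dense_sets n k s\<close> is thus at most the \<open>s\<close>-th
  power of a number that is at most 1, and the first power bounds it.\<close>

lemma dense_sum_le:
  assumes n: "1 \<le> n" and k: "1 \<le> k" and p: "0 \<le> p" "p \<le> n powr (- 2 / 3)"
    and M: "real M ^ k * n powr (- 1 / 12) \<le> 1"
  shows "(\<Sum>E\<in>(\<Union>s\<in>{1..M}. dense_sets n k s). p ^ card E) \<le> real M * (real M ^ k * n powr (- 1 / 12))"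
proof -
  let ?q = "real M ^ k * n powr (- 1 / 12)"
  have "(\<Sum>E\<in>(\<Union>s\<in>{1..M}. dense_sets n k s). p ^ card E) = (\<Sum>s\<in>{1..M}. \<Sum>E\<in>dense_sets n k s. p ^ card E)"
    by (rule sum.UNION_disjoint) (auto simp: finite_dense_sets, auto simp: dense_sets_def)
  also have "\<dots> \<le> (\<Sum>s\<in>{1..M}. ?q)"
  proof (intro sum_mono)
    fix s assume s: "s \<in> {1..M}"
    have "(\<Sum>E\<in>dense_sets n k s. p ^ card E) = (\<Sum>E\<in>dense_sets n k s. p ^ s)"
      by (intro sum.cong) (auto simp: dense_sets_def)
    also have "\<dots> = card (dense_sets n k s) * p ^ s" by simp
    also have "\<dots> \<le> (n ^ (7 * s div 12) * (s ^ k) ^ s) * p ^ s"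
      using card_dense_sets_le[of s k n] s k p(1)
      by (intro mult_right_mono) (simp_all only: of_nat_le_iff zero_le_power, simp)
    also have "\<dots> = real n ^ (7 * s div 12) * (p ^ s * (real s ^ k) ^ s)" by simp
    also have "\<dots> \<le> n powr (7 * s / 12) * ((n powr (- 2 / 3)) ^ s * (real M ^ k) ^ s)"
    proof (intro mult_mono power_mono)
      have "real n ^ (7 * s div 12) = n powr (real (7 * s div 12))" using n by (simp add: powr_realpow)
      also have "\<dots> \<le> n powr (7 * s / 12)"
        using n of_nat_div_le_of_nat[of "7 * s" 12] by (intro powr_mono) auto
      finally show "real n ^ (7 * s div 12) \<le> n powr (7 * s / 12)" .
    qed (use s p n in auto)
    also have "(n powr (- 2 / 3)) ^ s = n powr (- 2 * s / 3)"
      using n by (simp add: powr_realpow[symmetric] powr_powr)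
    also have "n powr (7 * s / 12) * (n powr (- 2 * s / 3) * (real M ^ k) ^ s) =
        n powr (7 * s / 12 + (- 2 * s / 3)) * (real M ^ k) ^ s"
      by (simp only: powr_add mult.assoc)
    also have "7 * s / 12 + (- 2 * s / 3) = (- 1 / 12) * real s" by simp
    also have "n powr ((- 1 / 12) * real s) = (n powr (- 1 / 12)) ^ s"
      using n by (simp add: powr_realpow[symmetric] powr_powr)
    also have "\<dots> * (real M ^ k) ^ s = ?q ^ s" by (simp add: power_mult_distrib mult.commute)
    also have "\<dots> \<le> ?q ^ 1" using s M by (intro power_decreasing) auto
    finally show "(\<Sum>E\<in>dense_sets n k s. p ^ card E) \<le> ?q" by simp
  qed
  finally show ?thesis by simp
qed

text \<open>On a list longer than \<open>M\<close> the inflated weight exceeds the true one by a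
  factor of at least \<open>lam ^ M\<close>; dividing by this factor yields the tail
  estimate.\<close>

lemma long_sum_le:
  assumes p: "0 \<le> p" and lam: "1 \<le> lam"
  shows "(\<Sum>L\<in>{L \<in> explore n k t M. M < length L}. p ^ card (set L)) \<le>
    weight (p * lam) (explore n k t M) / lam ^ M"
proof -
  have "(\<Sum>L\<in>{L \<in> explore n k t M. M < length L}. p ^ card (set L)) \<le>
      (\<Sum>L\<in>{L \<in> explore n k t M. M < length L}. (p * lam) ^ length L / lam ^ M)"
  proof (intro sum_mono)
    fix L assume L: "L \<in> {L \<in> explore n k t M. M < length L}"
    then have "distinct L" using explore_edge_list[of L n k t M] by (auto simp: edge_list_def)
    then have "card (set L) = length L" by (rule distinct_card)
    have "lam ^ M \<le> lam ^ length L" using L lam by (intro power_increasing) auto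
    then have "p ^ length L * lam ^ M \<le> p ^ length L * lam ^ length L"
      using p by (intro mult_left_mono) auto
    then show "p ^ card (set L) \<le> (p * lam) ^ length L / lam ^ M"
      using lam \<open>card (set L) = length L\<close> by (simp add: field_simps power_mult_distrib)
  qed
  also have "\<dots> \<le> (\<Sum>L\<in>explore n k t M. (p * lam) ^ length L / lam ^ M)"
    using p lam by (intro sum_mono2 finite_explore) auto
  finally show ?thesis by (simp add: weight_def sum_divide_distrib)
qed

text \<open>The possible outcomes of the exploration are enumerated independently of
  \<open>X\<close>, so a plain union bound applies: over the dense sets with at most
  \<open>M\<close> edges and over the outcomes longer than \<open>M\<close>.\<close>

lemma prob_stuck_le:
  assumes k: "1 \<le> k" and p: "0 \<le> p" "p \<le> 1"
  shows "measure_pmf.prob (bern (nsets {..<n} k) p)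
      {X. \<exists>E\<subseteq>{e \<in> nsets {..<n} k. X e}. stuck k (12 * k ^ 2) E} \<le>
    (\<Sum>E\<in>(\<Union>s\<in>{1..M}. dense_sets n k s). p ^ card E) +
    (\<Sum>L\<in>{L \<in> explore n k (12 * k ^ 2) M. M < length L}. p ^ card (set L))"
proof -
  let ?I = "nsets {..<n} k" and ?t = "12 * k ^ 2"
  let ?D = "\<Union>s\<in>{1..M}. dense_sets n k s"
  let ?R = "{L \<in> explore n k ?t M. M < length L}"
  have finI: "finite ?I" by (simp add: finite_imp_finite_nsets)
  have "{X. \<exists>E\<subseteq>{e \<in> ?I. X e}. stuck k ?t E} \<subseteq>
      {X. \<exists>E\<in>?D. \<forall>e\<in>E. X e} \<union> {X. \<exists>L\<in>?R. \<forall>e\<in>set L. X e}"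
  proof
    fix X assume "X \<in> {X. \<exists>E\<subseteq>{e \<in> ?I. X e}. stuck k ?t E}"
    then obtain E where E: "E \<subseteq> {e \<in> ?I. X e}" "stuck k ?t E" by blast
    have "E \<subseteq> ?I" using E(1) by blast
    from stuck_imp_small_or_long[OF E(2) this, of M]
    show "X \<in> {X. \<exists>E\<in>?D. \<forall>e\<in>E. X e} \<union> {X. \<exists>L\<in>?R. \<forall>e\<in>set L. X e}"
    proof
      assume "\<exists>E'\<subseteq>E. stuck k ?t E' \<and> card E' \<le> M"
      then obtain E' where E': "E' \<subseteq> E" "stuck k ?t E'" "card E' \<le> M" by blast
      have fin: "finite E'" using E' \<open>E \<subseteq> ?I\<close> finI by (meson finite_subset)
      have "E' \<noteq> {}" using E'(2) by (simp add: stuck_def)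
      then have "card E' \<in> {1..M}" using fin E'(3) by (simp add: Suc_le_eq card_gt_0_iff)
      moreover have "E' \<in> dense_sets n k (card E')"
        using stuck_imp_dense[OF E'(2) fin k] E'(1) \<open>E \<subseteq> ?I\<close> by (auto simp: dense_sets_def)
      ultimately have "E' \<in> ?D" by blast
      moreover have "\<forall>e\<in>E'. X e" using E' E by blast
      ultimately show ?thesis by blast
    next
      assume "\<exists>L\<in>explore n k ?t M. M < length L \<and> set L \<subseteq> E"
      then show ?thesis using E(1) by blast
    qed
  qed
  then have "measure_pmf.prob (bern ?I p) {X. \<exists>E\<subseteq>{e \<in> ?I. X e}. stuck k ?t E} \<le>
      measure_pmf.prob (bern ?I p) ({X. \<exists>E\<in>?D. \<forall>e\<in>E. X e} \<union> {X. \<exists>L\<in>?R. \<forall>e\<in>set L. X e})"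
    by (intro measure_pmf.finite_measure_mono) auto
  also have "\<dots> \<le> measure_pmf.prob (bern ?I p) {X. \<exists>E\<in>?D. \<forall>e\<in>E. X e} +
      measure_pmf.prob (bern ?I p) {X. \<exists>L\<in>?R. \<forall>e\<in>set L. X e}"
    by (rule measure_Un_le) auto
  also have "\<dots> \<le> (\<Sum>E\<in>?D. p ^ card E) + (\<Sum>L\<in>?R. p ^ card (set L))"
  proof (intro add_mono prob_bern_union_bound finI p)
    show "finite ?D" by (simp add: finite_dense_sets)
    show "finite ?R" by (simp add: finite_explore)
    show "E \<subseteq> ?I" if "E \<in> ?D" for E using that by (auto simp: dense_sets_def)
    show "set L \<subseteq> ?I" if "L \<in> ?R" for L
      using that explore_edge_list[of L n k ?t M] by (auto simp: edge_list_def)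
  qed
  finally show ?thesis .
qed

text \<open>The factor \<open>6 * k\<close> will serve as the inflation \<open>lam\<close>, twice
  the growth \<open>3 * k\<close> allowed per round. The remaining factor, with
  \<open>t = 12 * k ^ 2\<close>, keeps the main term of \<open>substep_factor\<close> at most
  \<open>1 / (2 * t)\<close> above 1.\<close>

definition lower_const :: "nat \<Rightarrow> real" where
  "lower_const k = 1 / (6 * k * (2 * (12 * k ^ 2) * triple_bound k))"

text \<open>The hypothesis on \<open>y\<close> makes the lower-order terms contribute at most
  another \<open>1 / (2 * t)\<close>. So a substep costs at most \<open>1 + 1 / t\<close>, the
  \<open>t\<close> substeps of a round at most \<open>exp 1 \<le> 3\<close>, and a round at most
  \<open>3 * k\<close>; against \<open>lam = 6 * k\<close> this leaves a factor 1/2 per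
  round.\<close>

lemma prob_long_le:
  fixes p y :: real and k t :: nat
  defines "t \<equiv> 12 * k ^ 2"
  assumes n: "1 \<le> n" and k: "1 \<le> k" and p: "0 \<le> p" "p \<le> lower_const k * n powr (- 2 / 3)"
    and y: "y = (3 + 3 * real t * M) * n powr (- 1 / 3)" "triple_bound k * (y + y\<^sup>2) \<le> 1 / (2 * t)"
  shows "(\<Sum>L\<in>{L \<in> explore n k t M. M < length L}. p ^ card (set L)) \<le>
    real n ^ Suc k * triple_bound k * (1 / 2) ^ M"
proof -
  let ?K = "real (triple_bound k)" and ?l = "3 + 3 * t * M"
  define x where "x = p * (6 * real k)"
  have K: "1 \<le> ?K" by (simp add: triple_bound_def)
  have "1 \<le> t" using k by (simp add: t_def Suc_le_eq)
  then have t: "1 \<le> real t" by simp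
  define a where "a = 1 / (2 * real t * ?K)"
  have a: "0 < a" "a \<le> 1"
    using K t mult_mono[of 1 "2 * real t" 1 ?K] by (auto simp: a_def)
  have ac: "a = lower_const k * (6 * real k)" using k by (simp add: a_def lower_const_def t_def)
  have x0: "0 \<le> x" using p by (simp add: x_def)
  have "x \<le> (lower_const k * n powr (- 2 / 3)) * (6 * real k)"
    unfolding x_def using p by (intro mult_right_mono) auto
  then have xa: "x \<le> a * n powr (- 2 / 3)" by (simp add: ac mult_ac)
  also have "\<dots> \<le> 1 * n powr (- 2 / 3)" using a by (intro mult_right_mono) auto
  finally have xn: "x \<le> n powr (- 2 / 3)" by simp
  also have "\<dots> \<le> n powr 0" using n by (intro powr_mono) auto
  finally have x1: "x \<le> 1" using n by simp
  have npos: "0 < real n" using n by simp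
  have h3: "(n powr (- 2 / 3)) ^ 3 = n powr (- 2)"
    and h2: "(n powr (- 2 / 3)) ^ 2 = n powr (- 4 / 3)"
    and h1: "(n powr (- 1 / 3)) ^ 2 = n powr (- 2 / 3)"
    using powr_power_real[OF npos, of "- 2 / 3" 3] powr_power_real[OF npos, of "- 2 / 3" 2]
      powr_power_real[OF npos, of "- 1 / 3" 2] by simp_all
  have g2: "real n ^ 2 * n powr (- 2) = 1" using npos by (simp add: powr_minus)
  have g1: "n * n powr (- 4 / 3) = n powr (- 1 / 3)"
    using npos powr_add[of "real n" 1 "- 4 / 3"] by simp
  have "real n ^ 2 * x ^ 3 \<le> real n ^ 2 * (a * n powr (- 2 / 3)) ^ 3"
    using xa x0 by (intro mult_left_mono power_mono) auto
  also have "\<dots> = a ^ 3 * (real n ^ 2 * n powr (- 2))"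
    by (simp only: power_mult_distrib h3 mult_ac)
  also have "\<dots> = a ^ 3" unfolding g2 by simp
  also have "\<dots> \<le> a ^ 1" using a by (intro power_decreasing) auto
  finally have s3: "real n ^ 2 * x ^ 3 \<le> a" by simp
  have "?l * n * x ^ 2 \<le> ?l * n * (n powr (- 2 / 3)) ^ 2"
    using xn x0 by (intro mult_left_mono power_mono) auto
  also have "\<dots> = real ?l * (n * n powr (- 4 / 3))"
    by (simp only: h2 mult.assoc of_nat_mult)
  also have "\<dots> = y" unfolding g1 y(1) by simp
  finally have s2: "?l * n * x ^ 2 \<le> y" .
  have "?l ^ 2 * x \<le> ?l ^ 2 * n powr (- 2 / 3)" using xn by (intro mult_left_mono) auto
  also have "\<dots> = y ^ 2" unfolding h1[symmetric] y(1) by (simp add: power_mult_distrib)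
  finally have s1: "?l ^ 2 * x \<le> y ^ 2" .
  have "substep_factor n k ?l x \<le> 1 + ?K * (a + y + y ^ 2)"
    unfolding substep_factor_def using s1 s2 s3 K by (intro add_left_mono mult_left_mono add_mono) auto
  also have "\<dots> = 1 + ?K * a + ?K * (y + y ^ 2)" by (simp add: algebra_simps)
  also have "?K * a = 1 / (2 * t)" using K t by (simp add: a_def)
  also have "1 + 1 / (2 * t) + ?K * (y + y ^ 2) \<le> 1 + 1 / (2 * t) + 1 / (2 * t)"
    using y(2) by simp
  also have "\<dots> = 1 + 1 / t" using t by (simp add: field_simps)
  also have "\<dots> \<le> exp (1 / t)" by (rule exp_ge_add_one_self)
  finally have "substep_factor n k ?l x ^ t \<le> exp (1 / t) ^ t"
    using substep_factor_ge_1[OF x0, of n k ?l] by (intro power_mono) auto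
  also have "\<dots> = exp 1" using t by (simp add: exp_of_nat_mult[symmetric])
  also have "\<dots> \<le> 3" by (rule exp_le)
  finally have \<rho>: "substep_factor n k ?l x ^ t \<le> 3" .
  have "(\<Sum>L\<in>{L \<in> explore n k t M. M < length L}. p ^ card (set L)) \<le>
      weight x (explore n k t M) / (6 * real k) ^ M"
    unfolding x_def using p k by (intro long_sum_le) auto
  also have "\<dots> \<le> (n ^ Suc k * ?K * x ^ 3 * (k * substep_factor n k ?l x ^ t) ^ M) / (6 * real k) ^ M"
    using x0 k weight_explore_le[of t M ?l x k n] by (intro divide_right_mono) auto
  also have "\<dots> \<le> (n ^ Suc k * ?K * 1 * (real k * 3) ^ M) / (6 * real k) ^ M"
  proof (intro divide_right_mono mult_mono)
    show "(real k * substep_factor n k ?l x ^ t) ^ M \<le> (real k * 3) ^ M"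
      using \<rho> substep_factor_ge_1[OF x0, of n k ?l] by (intro power_mono mult_left_mono) auto
    show "x ^ 3 \<le> 1" using x0 x1 by (intro power_le_one)
  qed (use x0 substep_factor_ge_1[OF x0, of n k ?l] in auto)
  also have "\<dots> = real n ^ Suc k * ?K * ((real k * 3) ^ M / (6 * real k) ^ M)"
    by (simp only: of_nat_power mult_1_right times_divide_eq_right)
  also have "(real k * 3) ^ M / (6 * real k) ^ M = ((real k * 3) / (6 * real k)) ^ M"
    by (rule power_divide[symmetric])
  also have "(real k * 3) / (6 * real k) = 1 / 2" using k by simp
  finally show ?thesis .
qed

lemma prob_stuck_tendsto_0:
  fixes p :: "nat \<Rightarrow> real"
  assumes k: "1 \<le> k" and p: "\<And>n. 0 \<le> p n \<and> p n \<le> 1"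
    and le: "\<forall>\<^sub>F n in sequentially. p n \<le> lower_const k * real n powr (- 2 / 3)"
  shows "(\<lambda>n. measure_pmf.prob (bern (nsets {..<n} k) (p n))
      {X. \<exists>E\<subseteq>{e \<in> nsets {..<n} k. X e}. stuck k (12 * k ^ 2) E}) \<longlonglongrightarrow> 0"
proof -
  define t where "t = 12 * k ^ 2"
  \<comment> \<open>The number of rounds \<open>M n\<close> is about \<open>n powr \<delta>\<close>.
    This is large enough for \<open>(1 / 2) ^ M n\<close> to beat every power of \<open>n\<close>,
    and small enough for \<open>M n ^ (k + 1)\<close> to cost only \<open>n powr (1 / 24)\<close>,
    half of the gain \<open>n powr (- 1 / 12)\<close> of the dense sets in the exponent.\<close>
  define \<delta> where "\<delta> = 1 / (24 * (real k + 1))"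
  have \<delta>: "0 < \<delta>" "\<delta> \<le> 1 / 24" by (auto simp: \<delta>_def field_simps)
  define M where "M n = nat \<lceil>real n powr \<delta>\<rceil>" for n
  define g where "g n = 2 ^ (k + 1) * real n powr (- 1 / 24) +
    triple_bound k * (real n ^ Suc k * (1 / 2) powr (real n powr \<delta>))" for n
  have g0: "g \<longlonglongrightarrow> 0"
  proof -
    have "(\<lambda>n. 2 ^ (k + 1) * real n powr (- 1 / 24)) \<longlonglongrightarrow> 0" by real_asymp
    moreover have "(\<lambda>n. real n ^ Suc k * (1 / 2) powr (real n powr \<delta>)) \<longlonglongrightarrow> 0"
      using \<delta>(1) by real_asymp
    ultimately have "g \<longlonglongrightarrow> 0 + real (triple_bound k) * 0"
      unfolding g_def by (intro tendsto_add tendsto_mult_left)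
    then show ?thesis by simp
  qed
  \<comment> \<open>An upper bound for the \<open>y\<close> of \<open>prob_long_le\<close>, with
    \<open>M n\<close> replaced by \<open>2 * n powr \<delta>\<close>; it vanishes because
    \<open>\<delta>\<close> is below 1/3.\<close>
  define z where "z n = (3 + 3 * real t * (2 * real n powr \<delta>)) * real n powr (- 1 / 3)" for n
  have "z \<longlonglongrightarrow> 0" unfolding z_def using \<delta> by real_asymp
  then have "(\<lambda>n. triple_bound k * (z n + (z n)\<^sup>2)) \<longlonglongrightarrow> real (triple_bound k) * (0 + 0\<^sup>2)"
    by (intro tendsto_intros)
  then have zs: "\<forall>\<^sub>F n in sequentially. triple_bound k * (z n + (z n)\<^sup>2) < 1 / (2 * t)"
    using k by (intro order_tendstoD) (auto simp: t_def)
  have small: "\<forall>\<^sub>F n in sequentially. 2 ^ (k + 1) * real n powr (- 1 / 24) < 1"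
    by (rule order_tendstoD[of _ 0]) (real_asymp, simp)
  show ?thesis
  proof (rule tendsto_sandwich[OF _ _ tendsto_const g0])
    show "\<forall>\<^sub>F n in sequentially. measure_pmf.prob (bern (nsets {..<n} k) (p n))
      {X. \<exists>E\<subseteq>{e \<in> nsets {..<n} k. X e}. stuck k (12 * k ^ 2) E} \<le> g n"
      using le zs small eventually_ge_at_top[of 1]
    proof eventually_elim
      case (elim n)
      have n1: "1 \<le> real n powr \<delta>" using elim \<delta> by (simp add: ge_one_powr_ge_zero)
      have M: "real n powr \<delta> \<le> M n" "real (M n) \<le> 2 * real n powr \<delta>"
        using n1 unfolding M_def by linarith+
      have c1: "lower_const k \<le> 1"
      proof -
        have "1 \<le> 6 * k * (2 * (12 * k ^ 2) * triple_bound k)"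
          using k by (simp add: Suc_le_eq triple_bound_def)
        then have "real 1 \<le> real (6 * k * (2 * (12 * k ^ 2) * triple_bound k))"
          by (simp only: of_nat_le_iff)
        then show ?thesis unfolding lower_const_def by (simp add: divide_le_eq_1)
      qed
      have p23: "p n \<le> real n powr (- 2 / 3)"
        using elim(1) mult_right_mono[OF c1, of "real n powr (- 2 / 3)"] by simp
      define y where "y = (3 + 3 * real t * M n) * real n powr (- 1 / 3)"
      have y: "0 \<le> y" "y \<le> z n"
        unfolding y_def z_def using M(2)
        by (simp, intro mult_right_mono add_left_mono mult_left_mono) auto
      have "triple_bound k * (y + y\<^sup>2) \<le> triple_bound k * (z n + (z n)\<^sup>2)"
        using y by (intro mult_left_mono add_mono power_mono) auto
      then have ys: "triple_bound k * (y + y\<^sup>2) \<le> 1 / (2 * t)" using elim(2) by linarith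
      have "real (M n) ^ (k + 1) \<le> (2 * real n powr \<delta>) ^ (k + 1)" using M by (intro power_mono) auto
      also have "\<dots> = 2 ^ (k + 1) * real n powr (\<delta> * real (k + 1))"
        using elim(4) by (simp only: power_mult_distrib powr_power_real of_nat_0_less_iff)
      also have "\<delta> * real (k + 1) = 1 / 24" by (simp add: \<delta>_def field_simps)
      finally have Mk: "real (M n) ^ (k + 1) \<le> 2 ^ (k + 1) * real n powr (1 / 24)" .
      have "real (M n) ^ (k + 1) * real n powr (- 1 / 12) \<le>
          (2 ^ (k + 1) * real n powr (1 / 24)) * real n powr (- 1 / 12)"
        using Mk by (intro mult_right_mono) auto
      also have "\<dots> = 2 ^ (k + 1) * real n powr (- 1 / 24)"
        by (simp add: mult.assoc powr_add[symmetric])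
      finally have MM: "real (M n) ^ (k + 1) * real n powr (- 1 / 12) \<le> 2 ^ (k + 1) * real n powr (- 1 / 24)" .
      have M1: "1 \<le> real (M n)" using n1 M by linarith
      have "real (M n) ^ k \<le> real (M n) ^ (k + 1)" using M1 by (intro power_increasing) auto
      then have "real (M n) ^ k * real n powr (- 1 / 12) \<le> real (M n) ^ (k + 1) * real n powr (- 1 / 12)"
        by (intro mult_right_mono) auto
      then have "real (M n) ^ k * real n powr (- 1 / 12) \<le> 1" using MM elim(3) by linarith
      then have d: "(\<Sum>E\<in>(\<Union>s\<in>{1..M n}. dense_sets n k s). p n ^ card E) \<le>
          2 ^ (k + 1) * real n powr (- 1 / 24)"
        using dense_sum_le[of n k "p n" "M n"] elim(4) k p[of n] p23 MM by (simp add: mult.assoc)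
      have "(\<Sum>L\<in>{L \<in> explore n k t (M n). M n < length L}. p n ^ card (set L)) \<le>
          real n ^ Suc k * triple_bound k * (1 / 2) ^ M n"
        unfolding t_def using elim k p[of n] ys
        by (intro prob_long_le[where y = y]) (auto simp: y_def t_def)
      also have "(1 / 2 :: real) ^ M n = (1 / 2) powr (M n)" by (simp add: powr_realpow)
      also have "\<dots> \<le> (1 / 2) powr (real n powr \<delta>)" using M by (intro powr_mono') auto
      finally have "(\<Sum>L\<in>{L \<in> explore n k t (M n). M n < length L}. p n ^ card (set L)) \<le>
          real n ^ Suc k * triple_bound k * (1 / 2) powr (real n powr \<delta>)"
        by (simp add: mult_left_mono)
      then show ?case
        using prob_stuck_le[of k "p n" n "M n"] k p[of n] d by (simp add: g_def t_def mult_ac)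
    qed
  qed (auto simp: measure_nonneg)
qed

section \<open>The 0-statement\<close>

text \<open>The vertices \<open>0\<close> to \<open>k\<close> are left for \<open>F1\<close> and
  those from \<open>2 * k\<close> on for the leaves of the star, so the three groups partition the
  vertex set of \<open>target\<close>.\<close>

definition core :: "nat \<Rightarrow> nat set" where
  "core k = {k<..<2 * k}"

definition target :: "nat \<Rightarrow> nat \<Rightarrow> nat hypergraph" where
  "target k t = ({..<2 * k + t},
     {{..k} - {0}, {..k} - {1}, {..k} - {2}} \<union> (\<lambda>x. insert x (core k)) ` {2 * k..<2 * k + t})"

lemma Diff_singleton_eq_iff: "a \<in> A \<Longrightarrow> b \<in> A \<Longrightarrow> A - {a} = A - {b} \<longleftrightarrow> a = b"
  by blast

lemma card_core: "card (core k) = k - 1"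
  by (simp add: core_def)

lemma uniform_target:
  assumes "2 \<le> k"
  shows "uniform_hypergraph k (target k t)"
proof -
  have "{..k} - {i} \<in> nsets {..<2 * k + t} k" if "i \<le> k" for i
    using that assms by (auto simp: nsets_def)
  moreover have "insert x (core k) \<in> nsets {..<2 * k + t} k" if "x \<in> {2 * k..<2 * k + t}" for x
  proof -
    have "finite (core k)" "x \<notin> core k" "insert x (core k) \<subseteq> {..<2 * k + t}"
      using that by (auto simp: core_def)
    then show ?thesis using assms by (simp add: nsets_def card_core)
  qed
  ultimately show ?thesis
    using assms unfolding uniform_hypergraph_def target_def by (simp add: image_subset_iff)
qed

text \<open>The three edges on \<open>{..k}\<close> alone have density (3 - 1) / ((k + 1) - k) = 2.
  The maximum is over a finite set since \<open>target\<close> has finitely many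
  subhypergraphs.\<close>

lemma m_density_target:
  assumes "2 \<le> k"
  shows "2 \<le> m_density k (target k t)"
proof -
  let ?F = "target k t" and ?H = "({..k}, {{..k} - {0}, {..k} - {1}, {..k} - {2}})"
  have sub: "subhypergraph ?H ?F" using assms by (auto simp: subhypergraph_def target_def)
  have "card {{..k} - {0}, {..k} - {1}, {..k} - {2}} = 3"
    using assms by (simp add: Diff_singleton_eq_iff)
  then have "d_density k ?H = 2" by (simp add: d_density_def)
  moreover have "d_density k ?H \<le> m_density k ?F"
    unfolding m_density_def
  proof (rule Max_ge)
    have "{H. subhypergraph H ?F} \<subseteq> Pow (hverts ?F) \<times> Pow (hedges ?F)"
      by (auto simp: subhypergraph_def)
    moreover have "finite (Pow (hverts ?F) \<times> Pow (hedges ?F))" by (simp add: target_def)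
    ultimately have "finite {H. subhypergraph H ?F}" by (rule finite_subset)
    then show "finite {d_density k H |H. subhypergraph H ?F}"
      unfolding setcompr_eq_image by (rule finite_imageI)
  qed (use sub in blast)
  ultimately show ?thesis by simp
qed

text \<open>Pull both components of \<open>target\<close> back along the inverse \<open>g\<close> of
  the isomorphism. That the edges of \<open>H\<close> lie in its vertex set ensures that
  \<open>g\<close> returns them unchanged.\<close>

lemma target_iso_imp:
  assumes "hypergraph_iso H (target k t)" "hedges H \<subseteq> Pow (hverts H)" "2 \<le> k"
  shows "\<exists>T\<subseteq>hedges H. triple k T"
    and "\<exists>S A. card S = k - 1 \<and> A \<subseteq> hedges H \<and> card A = t \<and> (\<forall>e\<in>A. S \<subseteq> e)"
proof -
  let ?F = "target k t"
  obtain f where f: "bij_betw f (hverts H) (hverts ?F)" "(\<lambda>e. f ` e) ` hedges H = hedges ?F"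
    using assms(1) by (auto simp: hypergraph_iso_def)
  define g where "g = inv_into (hverts H) f"
  have inj: "inj_on g (hverts ?F)"
    using bij_betw_inv_into[OF f(1)] by (simp add: g_def bij_betw_def)
  have edge: "g ` e' \<in> hedges H" if "e' \<in> hedges ?F" for e'
  proof -
    obtain e where e: "e \<in> hedges H" "e' = f ` e" using f(2) \<open>e' \<in> hedges ?F\<close> by blast
    have "e \<subseteq> hverts H" using e assms(2) by blast
    then have "g ` e' = e"
      unfolding e(2) g_def using f(1) by (simp add: bij_betw_def inv_into_image_cancel)
    then show ?thesis using e by simp
  qed
  have injP: "inj_on (\<lambda>e. g ` e) (Pow (hverts ?F))" using inj by (rule inj_on_image_Pow)
  have cardg: "card (g ` A) = card A" if "A \<subseteq> hverts ?F" for A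
    using inj_on_subset[OF inj that] by (rule card_image)
  let ?T = "{{..k} - {0}, {..k} - {1}, {..k} - {2}}"
  have V: "{..k} \<subseteq> hverts ?F" using assms(3) by (auto simp: target_def)
  have "triple k ((\<lambda>e. g ` e) ` ?T)"
    unfolding triple_def
  proof (intro conjI)
    have "card ((\<lambda>e. g ` e) ` ?T) = card ?T"
      by (rule card_image, rule inj_on_subset[OF injP]) (use V in blast)
    then show "card ((\<lambda>e. g ` e) ` ?T) = 3"
      using assms(3) by (simp add: Diff_singleton_eq_iff)
    have "\<Union>((\<lambda>e. g ` e) ` ?T) = g ` {..k}" by auto
    then show "card (\<Union>((\<lambda>e. g ` e) ` ?T)) = Suc k" using cardg[OF V] by simp
    have "finite (g ` ({..k} - {i})) \<and> card (g ` ({..k} - {i})) = k" if "i \<le> k" for i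
      using cardg[of "{..k} - {i}"] V that by auto
    then show "\<forall>e\<in>(\<lambda>e. g ` e) ` ?T. finite e \<and> card e = k" using assms(3) by simp
  qed
  moreover have "(\<lambda>e. g ` e) ` ?T \<subseteq> hedges H"
    by (rule image_subsetI, rule edge) (auto simp: target_def)
  ultimately show "\<exists>T\<subseteq>hedges H. triple k T" by blast
  let ?A = "(\<lambda>x. insert x (core k)) ` {2 * k..<2 * k + t}"
  have coreV: "core k \<subseteq> hverts ?F" and AV: "?A \<subseteq> Pow (hverts ?F)"
    by (auto simp: core_def target_def)
  have "inj_on (\<lambda>x. insert x (core k)) {2 * k..<2 * k + t}"
    by (rule inj_onI) (auto simp: core_def)
  then have "card ((\<lambda>e. g ` e) ` ?A) = t"
    using inj_on_subset[OF injP AV] by (simp add: card_image)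
  moreover have "(\<lambda>e. g ` e) ` ?A \<subseteq> hedges H"
    by (rule image_subsetI, rule edge) (auto simp: target_def)
  moreover have "card (g ` core k) = k - 1" using cardg[OF coreV] by (simp add: card_core)
  moreover have "\<forall>e\<in>(\<lambda>e. g ` e) ` ?A. g ` core k \<subseteq> e" by blast
  ultimately show "\<exists>S A. card S = k - 1 \<and> A \<subseteq> hedges H \<and> card A = t \<and> (\<forall>e\<in>A. S \<subseteq> e)" by blast
qed

text \<open>Without a stuck subset there is a colouring with no red triple and no blue star of
  \<open>t\<close> edges; every copy of \<open>target\<close> contains both patterns, so it cannot
  be monochromatic.\<close>

lemma arrows_imp_stuck:
  fixes E :: "nat set set"
  assumes "arrows (V, E) (target k t)" "finite E" "2 \<le> k" "0 < t"
  shows "\<exists>E'\<subseteq>E. stuck k t E'"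
proof (rule ccontr)
  assume "\<not> ?thesis"
  then obtain red where
    red: "\<And>T. T \<subseteq> E \<Longrightarrow> triple k T \<Longrightarrow> \<exists>e\<in>T. \<not> red e" and
    blue: "\<And>S. card S = k - 1 \<Longrightarrow> card {f \<in> E. S \<subseteq> f \<and> \<not> red f} < t"
    using not_stuck_imp_colouring[OF assms(2,4), of k] by blast
  obtain H b where H: "subhypergraph H (V, E)" "hypergraph_iso H (target k t)"
    and mono: "\<forall>e\<in>hedges H. red e = b"
    using assms(1) unfolding arrows_def by blast
  have HE: "hedges H \<subseteq> E" "hedges H \<subseteq> Pow (hverts H)" using H(1) by (auto simp: subhypergraph_def)
  note iso = target_iso_imp[OF H(2) HE(2) assms(3)]
  show False
  proof (cases b)
    case True
    obtain T where "T \<subseteq> hedges H" "triple k T" using iso(1) by blast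
    then show False using red[of T] HE(1) mono True by blast
  next
    case False
    obtain S A where A: "card S = k - 1" "A \<subseteq> hedges H" "card A = t" "\<forall>e\<in>A. S \<subseteq> e"
      using iso(2) by blast
    have "card A \<le> card {f \<in> E. S \<subseteq> f \<and> \<not> red f}"
      using A HE(1) mono False assms(2) by (intro card_mono) auto
    then show False using blue[OF A(1)] A(3) by simp
  qed
qed

lemma prob_random_hypergraph:
  "measure_pmf.prob (random_hypergraph k n p) {G. P G} =
     measure_pmf.prob (bern (nsets {..<n} k) p) {X. P ({..<n}, {e \<in> nsets {..<n} k. X e})}"
  by (simp add: random_hypergraph_def bern_def vimage_def)

lemma zero_statement:
  assumes k: "2 \<le> k" and p: "\<And>n. 0 \<le> p n \<and> p n \<le> 1"
    and le: "\<forall>\<^sub>F n in sequentially. p n \<le> lower_const k * real n powr (- 2 / 3)"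
  shows "(\<lambda>n. measure_pmf.prob (random_hypergraph k n (p n)) {G. arrows G (target k (12 * k ^ 2))}) \<longlonglongrightarrow> 0"
proof (rule tendsto_sandwich[OF _ _ tendsto_const prob_stuck_tendsto_0[OF _ p le]])
  show "\<forall>\<^sub>F n in sequentially. measure_pmf.prob (random_hypergraph k n (p n))
      {G. arrows G (target k (12 * k ^ 2))} \<le> measure_pmf.prob (bern (nsets {..<n} k) (p n))
      {X. \<exists>E\<subseteq>{e \<in> nsets {..<n} k. X e}. stuck k (12 * k ^ 2) E}"
  proof (intro always_eventually allI)
    fix n :: nat
    have "\<exists>E\<subseteq>{e \<in> nsets {..<n} k. X e}. stuck k (12 * k ^ 2) E"
      if "arrows ({..<n}, {e \<in> nsets {..<n} k. X e}) (target k (12 * k ^ 2))" for X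
      using arrows_imp_stuck[OF that] k by (simp add: finite_imp_finite_nsets)
    then show "measure_pmf.prob (random_hypergraph k n (p n))
      {G. arrows G (target k (12 * k ^ 2))} \<le> measure_pmf.prob (bern (nsets {..<n} k) (p n))
      {X. \<exists>E\<subseteq>{e \<in> nsets {..<n} k. X e}. stuck k (12 * k ^ 2) E}"
      unfolding prob_random_hypergraph by (intro measure_pmf.finite_measure_mono) auto
  qed
qed (use k in auto)

section \<open>The 1-statement\<close>

text \<open>The set \<open>U\<close> confines the copy to a block of vertices, so that copies of the
  two components found in disjoint blocks can be united; \<open>B\<close> will be a colour
  class.\<close>

definition has_F1 :: "nat \<Rightarrow> 'a set \<Rightarrow> 'a set set \<Rightarrow> bool" where
  "has_F1 k U B \<longleftrightarrow> (\<exists>W a b c. W \<subseteq> U \<and> finite W \<and> card W = Suc k \<and> {a, b, c} \<subseteq> W \<and>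
     a \<noteq> b \<and> a \<noteq> c \<and> b \<noteq> c \<and> {W - {a}, W - {b}, W - {c}} \<subseteq> B)"

definition has_F2 :: "nat \<Rightarrow> nat \<Rightarrow> 'a set \<Rightarrow> 'a set set \<Rightarrow> bool" where
  "has_F2 k t U B \<longleftrightarrow> (\<exists>S Z. S \<union> Z \<subseteq> U \<and> finite S \<and> card S = k - 1 \<and> finite Z \<and> card Z = t \<and>
     S \<inter> Z = {} \<and> (\<lambda>z. insert z S) ` Z \<subseteq> B)"

lemma ex_bij_betw_atMost:
  assumes "finite W" "card W = Suc k" "{a, b, c} \<subseteq> W" "a \<noteq> b" "a \<noteq> c" "b \<noteq> c"
  shows "\<exists>w. bij_betw w {..k} W \<and> w 0 = a \<and> w 1 = b \<and> w 2 = c"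
proof -
  obtain ws where ws: "set ws = W - {a, b, c}" "distinct ws"
    using finite_distinct_list[of "W - {a, b, c}"] assms(1) by auto
  let ?xs = "[a, b, c] @ ws"
  have d: "distinct ?xs" "set ?xs = W" using ws assms by auto
  then have len: "length ?xs = Suc k" using assms(2) distinct_card by metis
  have "bij_betw (nth ?xs) {..<length ?xs} (set ?xs)" using d(1) by (intro bij_betw_nth) auto
  then have "bij_betw (nth ?xs) {..k} W" unfolding len d(2) lessThan_Suc_atMost .
  moreover have "?xs ! 0 = a" "?xs ! 1 = b" "?xs ! 2 = c" by (simp_all add: numeral_2_eq_2)
  ultimately show ?thesis by blast
qed

text \<open>Disjointness of \<open>U1\<close> and \<open>U2\<close> lets bijections for the two
  components be glued to one map \<open>g\<close> from the vertices of
  \<open>target\<close>.\<close>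

lemma target_copy:
  assumes F1: "has_F1 k U1 B" and F2: "has_F2 k t U2 B" and disj: "U1 \<inter> U2 = {}"
    and V: "U1 \<union> U2 \<subseteq> V" and B: "B \<subseteq> E" and k: "2 \<le> k"
  shows "\<exists>H. subhypergraph H (V, E) \<and> hypergraph_iso H (target k t) \<and> hedges H \<subseteq> B"
proof -
  obtain W a b c where W: "W \<subseteq> U1" "finite W" "card W = Suc k" "{a, b, c} \<subseteq> W"
     "a \<noteq> b" "a \<noteq> c" "b \<noteq> c" "{W - {a}, W - {b}, W - {c}} \<subseteq> B"
    using F1 unfolding has_F1_def by (elim exE conjE)
  obtain S Z where S: "S \<union> Z \<subseteq> U2" "finite S" "card S = k - 1" "finite Z" "card Z = t"
     "S \<inter> Z = {}" "(\<lambda>z. insert z S) ` Z \<subseteq> B"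
    using F2 unfolding has_F2_def by (elim exE conjE)
  obtain w where w: "bij_betw w {..k} W" "w 0 = a" "w 1 = b" "w 2 = c"
    using ex_bij_betw_atMost[OF W(2-7)] by blast
  obtain s where s: "bij_betw s (core k) S"
    using finite_same_card_bij[of "core k" S] S by (auto simp: card_core core_def)
  obtain z where z: "bij_betw z {2 * k..<2 * k + t} Z"
    using finite_same_card_bij[of "{2 * k..<2 * k + t}" Z] S by auto
  define r where "r = (\<lambda>x. if x \<in> core k then s x else z x)"
  define g where "g = (\<lambda>x. if x \<in> {..k} then w x else r x)"
  have r: "bij_betw r (core k \<union> {2 * k..<2 * k + t}) (S \<union> Z)"
    unfolding r_def by (intro bij_betw_disjoint_Un s z) (use S in \<open>auto simp: core_def\<close>)
  have "bij_betw g ({..k} \<union> (core k \<union> {2 * k..<2 * k + t})) (W \<union> (S \<union> Z))"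
    unfolding g_def
    by (intro bij_betw_disjoint_Un w(1) r) (use S(1) W(1) disj k in \<open>auto simp: core_def\<close>)
  moreover have "{..k} \<union> (core k \<union> {2 * k..<2 * k + t}) = {..<2 * k + t}"
    using k by (auto simp: core_def)
  ultimately have g: "bij_betw g {..<2 * k + t} (W \<union> S \<union> Z)" by (simp add: Un_assoc)
  let ?E1 = "{W - {a}, W - {b}, W - {c}}" and ?E2 = "(\<lambda>z. insert z S) ` Z"
  let ?H = "(W \<union> S \<union> Z, ?E1 \<union> ?E2)"
  have gw: "g ` ({..k} - {i}) = W - {w i}" if "i \<le> k" for i
  proof -
    have "g ` ({..k} - {i}) = w ` ({..k} - {i})" by (intro image_cong) (auto simp: g_def)
    also have "\<dots> = w ` {..k} - w ` {i}"
      using w(1) that by (intro inj_on_image_set_diff[where C = "{..k}"]) (auto simp: bij_betw_def)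
    finally show ?thesis using w(1) by (simp add: bij_betw_def)
  qed
  have gcore: "g ` core k = S"
  proof -
    have "g ` core k = s ` core k" by (intro image_cong) (auto simp: g_def r_def core_def)
    then show ?thesis using s by (simp add: bij_betw_def)
  qed
  have gz: "g x = z x" if "x \<in> {2 * k..<2 * k + t}" for x
    using that k by (auto simp: g_def r_def core_def)
  have "(\<lambda>x. g ` insert x (core k)) ` {2 * k..<2 * k + t} = (\<lambda>x. insert (z x) S) ` {2 * k..<2 * k + t}"
    by (intro image_cong refl) (simp only: image_insert gcore gz)
  also have "\<dots> = (\<lambda>y. insert y S) ` (z ` {2 * k..<2 * k + t})" by (simp add: image_image)
  also have "z ` {2 * k..<2 * k + t} = Z" using z by (simp add: bij_betw_def)
  finally have E2: "(\<lambda>e. g ` e) ` (\<lambda>x. insert x (core k)) ` {2 * k..<2 * k + t} = ?E2"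
    by (simp add: image_image)
  have E: "(\<lambda>e. g ` e) ` hedges (target k t) = ?E1 \<union> ?E2"
    using gw[of 0] gw[of 1] gw[of 2] w(2-4) k E2 by (simp add: target_def image_Un)
  \<comment> \<open>\<open>hypergraph_iso\<close> asks for a map from the copy to
    \<open>target\<close>, hence the inverse of \<open>g\<close>.\<close>
  define f where "f = inv_into {..<2 * k + t} g"
  have f: "bij_betw f (W \<union> S \<union> Z) {..<2 * k + t}"
    unfolding f_def using g by (rule bij_betw_inv_into)
  have "hedges (target k t) \<subseteq> Pow {..<2 * k + t}"
    using uniform_target[OF k, of t] unfolding uniform_hypergraph_def nsets_def
    by (simp add: target_def[THEN arg_cong[where f = hverts]] subset_iff)
  then have "f ` g ` e = e" if "e \<in> hedges (target k t)" for e
    unfolding f_def using that g by (intro inv_into_image_cancel) (auto simp: bij_betw_def)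
  then have "(\<lambda>e. f ` e) ` (?E1 \<union> ?E2) = hedges (target k t)"
    unfolding E[symmetric] image_image by simp
  then have "hypergraph_iso ?H (target k t)"
    unfolding hypergraph_iso_def using f by (intro exI[of _ f]) (simp add: target_def)
  moreover have "subhypergraph ?H (V, E)"
  proof -
    have "W \<union> S \<union> Z \<subseteq> V" using W(1) S(1) V by blast
    moreover have "?E1 \<union> ?E2 \<subseteq> E" using W(8) S(7) B by blast
    ultimately show ?thesis unfolding subhypergraph_def by auto
  qed
  moreover have "hedges ?H \<subseteq> B" using W(8) S(7) by simp
  ultimately show ?thesis by blast
qed

text \<open>Let \<open>UA\<close> contain an \<open>F1\<close> of colour \<open>\<beta>\<close>.
  Then \<open>UB\<close> contains an \<open>F2\<close> of colour \<open>\<beta>\<close>, which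
  completes it, or an \<open>F1\<close> of the other colour. In the latter case both colours have an
  \<open>F1\<close>, and the monochromatic \<open>F2\<close> in \<open>UC\<close> fits one of
  them.\<close>

lemma arrows_target:
  assumes A: "\<And>col :: 'a set \<Rightarrow> bool. \<exists>\<beta>. has_F1 k UA {e \<in> E. col e = \<beta>}"
    and B: "\<And>(col :: 'a set \<Rightarrow> bool) \<beta>.
      has_F1 k UB {e \<in> E. col e = \<beta>} \<or> has_F2 k t UB {e \<in> E. col e = (\<not> \<beta>)}"
    and C: "\<And>col :: 'a set \<Rightarrow> bool. \<exists>\<beta>. has_F2 k t UC {e \<in> E. col e = \<beta>}"
    and disj: "UA \<inter> UB = {}" "UA \<inter> UC = {}" "UB \<inter> UC = {}"
    and V: "UA \<union> UB \<union> UC \<subseteq> V" and k: "2 \<le> k"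
  shows "arrows (V, E) (target k t)"
  unfolding arrows_def
proof
  fix col :: "'a set \<Rightarrow> bool"
  have "\<exists>\<beta> U1 U2. has_F1 k U1 {e \<in> E. col e = \<beta>} \<and> has_F2 k t U2 {e \<in> E. col e = \<beta>} \<and>
      U1 \<inter> U2 = {} \<and> U1 \<union> U2 \<subseteq> V"
  proof -
    obtain \<beta> where \<beta>: "has_F1 k UA {e \<in> E. col e = \<beta>}" using A by blast
    obtain \<gamma> where \<gamma>: "has_F2 k t UC {e \<in> E. col e = \<gamma>}" using C by blast
    consider "has_F2 k t UB {e \<in> E. col e = \<beta>}" | "has_F1 k UB {e \<in> E. col e = (\<not> \<beta>)}"
      using B[where col = col and \<beta> = "\<not> \<beta>"] by auto
    then show ?thesis
    proof cases
      case 1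
      then show ?thesis using \<beta> disj V by (intro exI[of _ \<beta>] exI[of _ UA] exI[of _ UB]) auto
    next
      case 2
      show ?thesis
      proof (cases "\<gamma> = \<beta>")
        case True
        then show ?thesis using \<beta> \<gamma> disj V by (intro exI[of _ \<beta>] exI[of _ UA] exI[of _ UC]) auto
      next
        case False
        then have "\<gamma> = (\<not> \<beta>)" by simp
        then show ?thesis using 2 \<gamma> disj V by (intro exI[of _ \<gamma>] exI[of _ UB] exI[of _ UC]) auto
      qed
    qed
  qed
  then obtain \<beta> U1 U2 where "has_F1 k U1 {e \<in> E. col e = \<beta>}" "has_F2 k t U2 {e \<in> E. col e = \<beta>}"
      "U1 \<inter> U2 = {}" "U1 \<union> U2 \<subseteq> V" by blast
  then obtain H where H: "subhypergraph H (V, E)" "hypergraph_iso H (target k t)"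
      "hedges H \<subseteq> {e \<in> E. col e = \<beta>}"
    using target_copy[of k U1 _ t U2 V E] k by blast
  then have "\<forall>e\<in>hedges H. col e = \<beta>" by blast
  with H(1,2) show "\<exists>H b. subhypergraph H (V, E) \<and> hypergraph_iso H (target k t) \<and>
      (\<forall>e\<in>hedges H. col e = b)" by blast
qed

text \<open>Three pairwise disjoint blocks of the vertex set force, respectively, a monochromatic
  \<open>F1\<close>, an \<open>F1\<close> in one given colour or an \<open>F2\<close> in the other, and a monochromatic \<open>F2\<close>.
  In the first block the last vertex of each \<open>(k+1)\<close>-set encodes the sum of the four others,
  so that different sets have no edge in common.\<close>

definition fixA :: "nat \<Rightarrow> nat \<Rightarrow> nat set" where "fixA k m = {12 * m..<12 * m + (k - 4)}"
definition fixB :: "nat \<Rightarrow> nat \<Rightarrow> nat set" where "fixB k m = {13 * m..<13 * m + (k - 2)}"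
definition fixC :: "nat \<Rightarrow> nat \<Rightarrow> nat set" where "fixC k m = {14 * m..<14 * m + (k - 1)}"

text \<open>The range up to \<open>8 * m\<close> holds four coordinates below \<open>m\<close> in
  intervals of length \<open>m\<close>, then their sum, which is below \<open>4 * m\<close>. The
  fixed parts start at \<open>12 * m\<close>, \<open>13 * m\<close> and \<open>14 * m\<close>; for
  \<open>k \<le> m\<close> they are disjoint and everything lies below
  \<open>15 * m\<close>.\<close>

definition blockA :: "nat \<Rightarrow> nat \<Rightarrow> nat set" where "blockA k m = {..<8 * m} \<union> fixA k m"
definition blockB :: "nat \<Rightarrow> nat \<Rightarrow> nat set" where "blockB k m = {8 * m..<11 * m} \<union> fixB k m"
definition blockC :: "nat \<Rightarrow> nat \<Rightarrow> nat set" where "blockC k m = {11 * m..<12 * m} \<union> fixC k m"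

definition indexA :: "nat \<Rightarrow> (nat \<times> nat \<times> nat \<times> nat) set" where
  "indexA m = {..<m} \<times> {..<m} \<times> {..<m} \<times> {..<m}"

fun vertsA :: "nat \<Rightarrow> nat \<times> nat \<times> nat \<times> nat \<Rightarrow> nat set" where
  "vertsA m (a, b, c, d) = {a, m + b, 2 * m + c, 3 * m + d, 4 * m + (a + b + c + d)}"

text \<open>Only the edges omitting one of the five variable vertices are used. Five edges suffice
  for the pigeonhole principle, and the expected number \<open>m ^ 4 * p ^ 5\<close> of complete
  systems is of order \<open>n powr (2 / 3)\<close> when \<open>p\<close> is of order
  \<open>n powr (- 2 / 3)\<close>.\<close>

definition edgesA :: "nat \<Rightarrow> nat \<Rightarrow> nat \<times> nat \<times> nat \<times> nat \<Rightarrow> nat set set" where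
  "edgesA k m q = (\<lambda>v. (vertsA m q \<union> fixA k m) - {v}) ` vertsA m q"

lemma vertsA:
  assumes "q \<in> indexA m"
  shows "finite (vertsA m q)" "card (vertsA m q) = 5" "vertsA m q \<subseteq> {..<8 * m}"
  using assms by (cases q; auto simp: indexA_def)+

lemma vertsA_fixA:
  assumes "q \<in> indexA m" "4 \<le> k"
  shows "vertsA m q \<inter> fixA k m = {}" "card (vertsA m q \<union> fixA k m) = Suc k"
proof -
  show disj: "vertsA m q \<inter> fixA k m = {}" using vertsA(3)[OF assms(1)] by (auto simp: fixA_def)
  show "card (vertsA m q \<union> fixA k m) = Suc k"
    using vertsA[OF assms(1)] assms(2) disj by (subst card_Un_disjoint) (auto simp: fixA_def)
qed

lemma edgesA:
  assumes "q \<in> indexA m" "4 \<le> k" "k \<le> m" "15 * m \<le> n"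
  shows "edgesA k m q \<subseteq> nsets {..<n} k" "card (edgesA k m q) = 5"
proof -
  note v = vertsA[OF assms(1)] and w = vertsA_fixA[OF assms(1,2)]
  have sub: "vertsA m q \<union> fixA k m \<subseteq> {..<n}" using v(3) assms by (auto simp: fixA_def)
  have fin: "finite (vertsA m q \<union> fixA k m)" using v(1) by (simp add: fixA_def)
  show "edgesA k m q \<subseteq> nsets {..<n} k"
    unfolding edgesA_def using w(2) sub fin by (auto simp: nsets_def)
  have "inj_on (\<lambda>v. (vertsA m q \<union> fixA k m) - {v}) (vertsA m q)" by (rule inj_onI) blast
  then show "card (edgesA k m q) = 5" unfolding edgesA_def by (simp add: card_image v(2))
qed

text \<open>A common edge contains all vertices of \<open>q\<close> but one. The offsets identify
  which coordinate a vertex encodes, so four of the five numbers \<open>a\<close>, \<open>b\<close>,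
  \<open>c\<close>, \<open>d\<close> and their sum agree, and these determine the fifth.\<close>

lemma edgesA_disjoint:
  assumes q: "q \<in> indexA m" "q' \<in> indexA m" "edgesA k m q \<inter> edgesA k m q' \<noteq> {}"
  shows "q = q'"
proof -
  obtain v v' where v: "v \<in> vertsA m q" "v' \<in> vertsA m q'"
    "(vertsA m q \<union> fixA k m) - {v} = (vertsA m q' \<union> fixA k m) - {v'}"
    using q(3) by (auto simp: edgesA_def)
  obtain a b c d where Q: "q = (a, b, c, d)" by (cases q)
  obtain a' b' c' d' where Q': "q' = (a', b', c', d')" by (cases q')
  have lt: "a < m" "b < m" "c < m" "d < m" "a' < m" "b' < m" "c' < m" "d' < m"
    using q(1,2) by (auto simp: indexA_def Q Q')
  have mem: "x \<in> vertsA m q'" if "x \<in> vertsA m q" "x \<noteq> v" for x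
  proof -
    have "x \<in> vertsA m q' \<union> fixA k m" using that v(3) by blast
    moreover have "x \<notin> fixA k m" using vertsA(3)[OF q(1)] that(1) by (auto simp: fixA_def)
    ultimately show ?thesis by blast
  qed
  have 1: "a = v \<or> a = a'" using mem[of a] lt by (auto simp: Q Q')
  have 2: "m + b = v \<or> b = b'" using mem[of "m + b"] lt by (auto simp: Q Q')
  have 3: "2 * m + c = v \<or> c = c'" using mem[of "2 * m + c"] lt by (auto simp: Q Q')
  have 4: "3 * m + d = v \<or> d = d'" using mem[of "3 * m + d"] lt by (auto simp: Q Q')
  have 5: "4 * m + (a + b + c + d) = v \<or> a + b + c + d = a' + b' + c' + d'"
    using mem[of "4 * m + (a + b + c + d)"] lt by (auto simp: Q Q')
  have "a = a' \<and> b = b' \<and> c = c' \<and> d = d'"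
    using v(1) 1 2 3 4 5 lt unfolding Q vertsA.simps by (elim insertE emptyE) simp_all
  then show ?thesis by (simp add: Q Q')
qed

lemma blockA_mono:
  fixes col :: "nat set \<Rightarrow> bool"
  assumes q: "q \<in> indexA m" "4 \<le> k" "edgesA k m q \<subseteq> E"
  shows "\<exists>\<beta>. has_F1 k (blockA k m) {e \<in> E. col e = \<beta>}"
proof -
  let ?W = "vertsA m q \<union> fixA k m"
  note v = vertsA[OF q(1)] and w = vertsA_fixA[OF q(1,2)]
  let ?P = "\<lambda>\<beta>. {x \<in> vertsA m q. col (?W - {x}) = \<beta>}"
  have "card (?P True) + card (?P False) = card (?P True \<union> ?P False)"
    using v(1) by (intro card_Un_disjoint[symmetric]) auto
  also have "?P True \<union> ?P False = vertsA m q" by auto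
  finally have "3 \<le> card (?P True) \<or> 3 \<le> card (?P False)" using v(2) by linarith
  then obtain \<beta> where "3 \<le> card (?P \<beta>)" by blast
  then obtain T where T: "T \<subseteq> ?P \<beta>" "card T = 3" "finite T"
    by (rule obtain_subset_with_card_n)
  then obtain a b c where abc: "T = {a, b, c}" "a \<noteq> b" "a \<noteq> c" "b \<noteq> c" by (auto simp: card_3_iff)
  have "{?W - {a}, ?W - {b}, ?W - {c}} \<subseteq> {e \<in> E. col e = \<beta>}"
    using T(1) q(3) unfolding abc edgesA_def by auto
  moreover have "?W \<subseteq> blockA k m" using v(3) by (auto simp: blockA_def)
  moreover have "finite ?W" using v(1) by (simp add: fixA_def)
  moreover have "{a, b, c} \<subseteq> ?W" using T(1) unfolding abc by auto
  ultimately show ?thesis unfolding has_F1_def using w(2) abc(2-4) by blast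
qed

text \<open>A single edge wrapped as a family, the shape that \<open>ncontained\<close>
  counts.\<close>

definition edgesC :: "nat \<Rightarrow> nat \<Rightarrow> nat \<Rightarrow> nat set set" where
  "edgesC k m x = {insert (11 * m + x) (fixC k m)}"

lemma edgesC_subset:
  assumes "x < m" "1 \<le> k" "k \<le> m" "15 * m \<le> n"
  shows "edgesC k m x \<subseteq> nsets {..<n} k"
proof -
  have "11 * m + x \<notin> fixC k m" "insert (11 * m + x) (fixC k m) \<subseteq> {..<n}"
    using assms by (auto simp: fixC_def)
  then show ?thesis using assms by (simp add: edgesC_def nsets_def fixC_def)
qed

lemma edgesC_disjoint:
  assumes "x < m" "y < m" "edgesC k m x \<inter> edgesC k m y \<noteq> {}"
  shows "x = y"
proof -
  have "11 * m + x \<in> insert (11 * m + y) (fixC k m)" using assms(3) by (auto simp: edgesC_def)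
  then show ?thesis using assms by (auto simp: fixC_def)
qed

lemma blockC_mono:
  fixes col :: "nat set \<Rightarrow> bool"
  assumes "2 * t \<le> card {x \<in> {..<m}. edgesC k m x \<subseteq> E}" "1 \<le> k"
  shows "\<exists>\<beta>. has_F2 k t (blockC k m) {e \<in> E. col e = \<beta>}"
proof -
  let ?X = "{x \<in> {..<m}. edgesC k m x \<subseteq> E}"
  let ?P = "\<lambda>\<beta>. {x \<in> ?X. col (insert (11 * m + x) (fixC k m)) = \<beta>}"
  have "card (?P True) + card (?P False) = card (?P True \<union> ?P False)"
    by (intro card_Un_disjoint[symmetric]) auto
  also have "?P True \<union> ?P False = ?X" by auto
  finally have "t \<le> card (?P True) \<or> t \<le> card (?P False)" using assms(1) by linarith
  then obtain \<beta> where "t \<le> card (?P \<beta>)" by blast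
  then obtain T where T: "T \<subseteq> ?P \<beta>" "card T = t" "finite T"
    by (rule obtain_subset_with_card_n)
  let ?Z = "(\<lambda>x. 11 * m + x) ` T"
  have "card ?Z = t" using T(2) by (simp add: card_image)
  moreover have "fixC k m \<union> ?Z \<subseteq> blockC k m" using T(1) by (auto simp: blockC_def)
  moreover have "fixC k m \<inter> ?Z = {}" using T(1) by (auto simp: fixC_def)
  moreover have "(\<lambda>z. insert z (fixC k m)) ` ?Z \<subseteq> {e \<in> E. col e = \<beta>}"
    using T(1) by (auto simp: edgesC_def)
  ultimately show ?thesis
    unfolding has_F2_def using T(3) by (intro exI[of _ \<beta>] exI[of _ "fixC k m"] exI[of _ ?Z]) (auto simp: fixC_def)
qed

section \<open>Block B: triangles in the tripartite link graph of a fixed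
  \<open>(k - 2)\<close>-set\<close>

definition linkB :: "nat \<Rightarrow> nat \<Rightarrow> nat \<Rightarrow> nat \<Rightarrow> nat set" where
  "linkB k m u w = {u, w} \<union> fixB k m"

definition indexB :: "nat \<Rightarrow> (nat \<times> nat \<times> nat) set" where
  "indexB m = {..<m} \<times> {..<m} \<times> {..<m}"

fun edgesB :: "nat \<Rightarrow> nat \<Rightarrow> nat \<times> nat \<times> nat \<Rightarrow> nat set set" where
  "edgesB k m (x, y, z) = {linkB k m (8 * m + x) (9 * m + y),
     linkB k m (8 * m + x) (10 * m + z), linkB k m (9 * m + y) (10 * m + z)}"

declare edgesB.simps [simp del]

definition overlapB :: "nat \<Rightarrow> nat \<Rightarrow> ((nat \<times> nat \<times> nat) \<times> (nat \<times> nat \<times> nat)) set" where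
  "overlapB k m = {(i, j) \<in> indexB m \<times> indexB m. i \<noteq> j \<and> edgesB k m i \<inter> edgesB k m j \<noteq> {}}"

lemma linkB_eq_iff:
  assumes "{u, w, u', w'} \<subseteq> {8 * m..<11 * m}"
  shows "linkB k m u w = linkB k m u' w' \<longleftrightarrow> {u, w} = {u', w'}"
proof
  have "linkB k m a b \<inter> {8 * m..<11 * m} = {a, b}" if "{a, b} \<subseteq> {8 * m..<11 * m}" for a b
    using that by (auto simp: linkB_def fixB_def)
  from this[of u w] this[of u' w'] show "{u, w} = {u', w'}" if "linkB k m u w = linkB k m u' w'"
    using that assms by auto
qed (simp add: linkB_def)

lemma linkB_nsets:
  assumes "{u, w} \<subseteq> {8 * m..<11 * m}" "u \<noteq> w" "2 \<le> k" "k \<le> m" "15 * m \<le> n"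
  shows "linkB k m u w \<in> nsets {..<n} k"
proof -
  have "card ({u, w} \<union> fixB k m) = card {u, w} + card (fixB k m)"
    using assms by (intro card_Un_disjoint) (auto simp: fixB_def)
  then show ?thesis using assms by (auto simp: linkB_def nsets_def fixB_def)
qed

lemma edgesB_inter:
  assumes "(x, y, z) \<in> indexB m" "(x', y', z') \<in> indexB m"
  shows "linkB k m (8 * m + x) (9 * m + y) \<in> edgesB k m (x', y', z') \<longleftrightarrow> x = x' \<and> y = y'"
    "linkB k m (8 * m + x) (10 * m + z) \<in> edgesB k m (x', y', z') \<longleftrightarrow> x = x' \<and> z = z'"
    "linkB k m (9 * m + y) (10 * m + z) \<in> edgesB k m (x', y', z') \<longleftrightarrow> y = y' \<and> z = z'"
proof -
  have lt: "x < m" "y < m" "z < m" "x' < m" "y' < m" "z' < m"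
    using assms by (auto simp: indexB_def)
  show "linkB k m (8 * m + x) (9 * m + y) \<in> edgesB k m (x', y', z') \<longleftrightarrow> x = x' \<and> y = y'"
    using lt by (simp add: edgesB.simps linkB_eq_iff) (auto simp: doubleton_eq_iff)
  show "linkB k m (8 * m + x) (10 * m + z) \<in> edgesB k m (x', y', z') \<longleftrightarrow> x = x' \<and> z = z'"
    using lt by (simp add: edgesB.simps linkB_eq_iff) (auto simp: doubleton_eq_iff)
  show "linkB k m (9 * m + y) (10 * m + z) \<in> edgesB k m (x', y', z') \<longleftrightarrow> y = y' \<and> z = z'"
    using lt by (simp add: edgesB.simps linkB_eq_iff) (auto simp: doubleton_eq_iff)
qed

lemma edgesB:
  assumes "i \<in> indexB m" "2 \<le> k" "k \<le> m" "15 * m \<le> n"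
  shows "edgesB k m i \<subseteq> nsets {..<n} k" "card (edgesB k m i) = 3" "finite (edgesB k m i)"
proof -
  obtain x y z where i: "i = (x, y, z)" by (cases i)
  show "edgesB k m i \<subseteq> nsets {..<n} k"
    using assms by (auto simp: i edgesB.simps indexB_def intro!: linkB_nsets)
  show "card (edgesB k m i) = 3"
    using assms(1) by (auto simp: i edgesB.simps indexB_def linkB_eq_iff doubleton_eq_iff card_insert_if)
  show "finite (edgesB k m i)" by (simp add: i edgesB.simps)
qed

text \<open>Two common edges would fix all three coordinates, so distinct overlapping triangles
  share exactly one edge, and 3 + 3 - 1 = 5.\<close>

lemma card_edgesB_Un:
  assumes "(i, j) \<in> overlapB k m" "2 \<le> k" "k \<le> m"
  shows "card (edgesB k m i \<union> edgesB k m j) = 5"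
proof -
  obtain x y z x' y' z' where ij: "i = (x, y, z)" "j = (x', y', z')" by (cases i; cases j)
  have I: "(x, y, z) \<in> indexB m" "(x', y', z') \<in> indexB m" and ne: "i \<noteq> j"
    and ov: "edgesB k m i \<inter> edgesB k m j \<noteq> {}"
    using assms(1) by (simp_all add: overlapB_def ij)
  note iff = edgesB_inter[OF I, of k]
  have "card (edgesB k m i \<inter> edgesB k m j) = 1"
  proof -
    obtain e where e: "e \<in> edgesB k m i" "e \<in> edgesB k m j" using ov by blast
    have "f = e" if "f \<in> edgesB k m i" "f \<in> edgesB k m j" for f
      using that e ne iff unfolding ij edgesB.simps[of k m x y z]
      by (elim insertE emptyE) auto
    then have "edgesB k m i \<inter> edgesB k m j = {e}" using e by blast
    then show ?thesis by simp
  qed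
  moreover have "card (edgesB k m i) = 3" "card (edgesB k m j) = 3" "finite (edgesB k m i)" "finite (edgesB k m j)"
    using edgesB[of _ m k "15 * m"] I assms(2,3) by (auto simp only: ij)
  ultimately show ?thesis using card_Un_Int[of "edgesB k m i" "edgesB k m j"] by simp
qed

lemma finite_indexB: "finite (indexB m)" and card_indexB: "card (indexB m) = m ^ 3"
  by (simp_all add: indexB_def card_cartesian_product power3_eq_cube)

lemma finite_overlapB: "finite (overlapB k m)"
  by (rule finite_subset[of _ "indexB m \<times> indexB m"]) (auto simp: overlapB_def finite_indexB)

text \<open>A shared edge fixes two coordinates of the second triangle. There are three choices for
  this pair and four free coordinates altogether.\<close>

lemma card_overlapB_le: "card (overlapB k m) \<le> 3 * m ^ 4"
proof -
  let ?Q = "{..<m} \<times> {..<m} \<times> {..<m} \<times> {..<m}"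
  let ?f = "\<lambda>(x, y, z, z'). ((x, y, z), (x, y, z'))"
  let ?g = "\<lambda>(x, y, z, y'). ((x, y, z), (x, y', z))"
  let ?h = "\<lambda>(x, y, z, x'). ((x, y, z), (x', y, z))"
  have "overlapB k m \<subseteq> ?f ` ?Q \<union> ?g ` ?Q \<union> ?h ` ?Q"
  proof
    fix ij assume ij: "ij \<in> overlapB k m"
    obtain x y z x' y' z' where eq: "ij = ((x, y, z), (x', y', z'))" by (metis prod_cases3 surj_pair)
    have I: "(x, y, z) \<in> indexB m" "(x', y', z') \<in> indexB m"
      and ov: "edgesB k m (x, y, z) \<inter> edgesB k m (x', y', z') \<noteq> {}"
      using ij by (simp_all add: overlapB_def eq)
    obtain e where e: "e \<in> edgesB k m (x, y, z)" "e \<in> edgesB k m (x', y', z')" using ov by blast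
    have "x = x' \<and> y = y' \<or> x = x' \<and> z = z' \<or> y = y' \<and> z = z'"
      using e edgesB_inter[OF I, of k] unfolding edgesB.simps[of k m x y z]
      by (elim insertE emptyE) auto
    then consider "x' = x" "y' = y" | "x' = x" "z' = z" | "y' = y" "z' = z" by blast
    then show "ij \<in> ?f ` ?Q \<union> ?g ` ?Q \<union> ?h ` ?Q"
    proof cases
      case 1
      then have "ij = ?f (x, y, z, z')" by (simp add: eq)
      moreover have "(x, y, z, z') \<in> ?Q" using I by (auto simp: indexB_def)
      ultimately show ?thesis by blast
    next
      case 2
      then have "ij = ?g (x, y, z, y')" by (simp add: eq)
      moreover have "(x, y, z, y') \<in> ?Q" using I by (auto simp: indexB_def)
      ultimately show ?thesis by blast
    next
      case 3
      then have "ij = ?h (x, y, z, x')" by (simp add: eq)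
      moreover have "(x, y, z, x') \<in> ?Q" using I by (auto simp: indexB_def)
      ultimately show ?thesis by blast
    qed
  qed
  then have "card (overlapB k m) \<le> card (?f ` ?Q \<union> ?g ` ?Q \<union> ?h ` ?Q)"
    by (intro card_mono) auto
  also have "\<dots> \<le> card (?f ` ?Q) + card (?g ` ?Q) + card (?h ` ?Q)"
    by (meson add_le_mono1 card_Un_le order_trans)
  also have "\<dots> \<le> card ?Q + card ?Q + card ?Q"
    by (intro add_mono card_image_le) auto
  also have "card ?Q = m ^ 4" by (simp add: card_cartesian_product eval_nat_numeral)
  finally show ?thesis by simp
qed

text \<open>If both alternatives fail, the edges of colour \<open>\<not> \<beta>\<close> have degree
  at most \<open>t\<close> in the link graph on \<open>3 * m\<close> vertices, hence number at most
  \<open>3 * m * t\<close>, and every present triangle contains one of them. After discarding the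
  triangles that overlap another present one, these edges are distinct, which contradicts
  \<open>many\<close>.\<close>

lemma blockB_asym:
  fixes col :: "nat set \<Rightarrow> bool"
  assumes many: "3 * m * t + card {(i, j) \<in> overlapB k m. edgesB k m i \<union> edgesB k m j \<subseteq> E} <
      card {i \<in> indexB m. edgesB k m i \<subseteq> E}"
    and k: "2 \<le> k" "k \<le> m"
  shows "has_F1 k (blockB k m) {e \<in> E. col e = \<beta>} \<or> has_F2 k t (blockB k m) {e \<in> E. col e = (\<not> \<beta>)}"
proof (rule ccontr)
  assume neg: "\<not> ?thesis"
  let ?I = "{8 * m..<11 * m}"
  define Xs where "Xs = {i \<in> indexB m. edgesB k m i \<subseteq> E}"
  define Ys where "Ys = {(i, j) \<in> overlapB k m. edgesB k m i \<union> edgesB k m j \<subseteq> E}"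
  define Z where "Z u = {w \<in> ?I. w \<noteq> u \<and> linkB k m u w \<in> E \<and> col (linkB k m u w) = (\<not> \<beta>)}" for u
  define Bl where "Bl = (\<Union>u\<in>?I. linkB k m u ` Z u)"
  have finZ: "finite (Z u)" for u by (simp add: Z_def)
  have finX: "finite Xs" by (simp add: Xs_def finite_indexB)
  have finY: "finite Ys" by (rule finite_subset[OF _ finite_overlapB[of k m]]) (auto simp: Ys_def)
  have finB: "finite Bl" by (simp add: Bl_def finZ)
  have cZ: "card (Z u) \<le> t" if u: "u \<in> ?I" for u
  proof (rule ccontr)
    assume "\<not> card (Z u) \<le> t"
    then have "t \<le> card (Z u)" by simp
    then obtain T where T: "T \<subseteq> Z u" "card T = t" "finite T" by (rule obtain_subset_with_card_n)
    let ?S = "insert u (fixB k m)"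
    have "card ?S = k - 1" using u k by (simp add: fixB_def card_insert_if)
    moreover have "?S \<union> T \<subseteq> blockB k m" using u T(1) by (auto simp: blockB_def Z_def)
    moreover have "?S \<inter> T = {}" using T(1) by (auto simp: Z_def fixB_def)
    moreover have "(\<lambda>z. insert z ?S) ` T \<subseteq> {e \<in> E. col e = (\<not> \<beta>)}"
    proof (rule image_subsetI)
      fix z assume "z \<in> T"
      then have "z \<in> Z u" using T(1) by blast
      moreover have "insert z ?S = linkB k m u z" by (auto simp: linkB_def)
      ultimately show "insert z ?S \<in> {e \<in> E. col e = (\<not> \<beta>)}" by (simp add: Z_def)
    qed
    moreover have "finite ?S" by (simp add: fixB_def)
    ultimately have "has_F2 k t (blockB k m) {e \<in> E. col e = (\<not> \<beta>)}"
      unfolding has_F2_def using T by (intro exI[of _ ?S] exI[of _ T] conjI)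
    then show False using neg by simp
  qed
  have "card Bl \<le> (\<Sum>u\<in>?I. card (linkB k m u ` Z u))" unfolding Bl_def by (rule card_UN_le) simp
  also have "\<dots> \<le> (\<Sum>u\<in>?I. t)"
    by (intro sum_mono order_trans[OF card_image_le[OF finZ] cZ])
  finally have cB: "card Bl \<le> 3 * m * t" by simp
  have linkBl: "linkB k m u w \<in> Bl"
    if "u \<in> ?I" "w \<in> ?I" "w \<noteq> u" "linkB k m u w \<in> E" "col (linkB k m u w) \<noteq> \<beta>" for u w
    using that unfolding Bl_def Z_def by blast
  have "\<exists>e. e \<in> edgesB k m i \<and> e \<in> Bl" if i: "i \<in> Xs" for i
  proof (rule ccontr)
    assume no: "\<not> ?thesis"
    obtain x y z where xyz: "i = (x, y, z)" by (cases i)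
    have lt: "x < m" "y < m" "z < m" and E: "edgesB k m (x, y, z) \<subseteq> E"
      using i by (auto simp: Xs_def indexB_def xyz)
    let ?a = "8 * m + x" and ?b = "9 * m + y" and ?c = "10 * m + z"
    \<comment> \<open>The triangle and the fixed part form a \<open>(k + 1)\<close>-set; deleting a
      corner leaves the hyperedge of the opposite side, so a triangle of colour
      \<open>\<beta>\<close> is an \<open>F1\<close>.\<close>
    let ?W = "{?a, ?b, ?c} \<union> fixB k m"
    have abc: "?a \<in> ?I" "?b \<in> ?I" "?c \<in> ?I" "?b \<noteq> ?a" "?c \<noteq> ?a" "?c \<noteq> ?b" using lt by auto
    have nf: "?a \<notin> fixB k m" "?b \<notin> fixB k m" "?c \<notin> fixB k m" using lt by (auto simp: fixB_def)
    have E3: "linkB k m ?a ?b \<in> E" "linkB k m ?a ?c \<in> E" "linkB k m ?b ?c \<in> E"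
      using E by (auto simp: edgesB.simps)
    have N3: "linkB k m ?a ?b \<notin> Bl" "linkB k m ?a ?c \<notin> Bl" "linkB k m ?b ?c \<notin> Bl"
      using no by (auto simp: edgesB.simps xyz)
    have C3: "col (linkB k m ?a ?b) = \<beta>" "col (linkB k m ?a ?c) = \<beta>" "col (linkB k m ?b ?c) = \<beta>"
      using linkBl[OF abc(1,2,4) E3(1)] linkBl[OF abc(1,3,5) E3(2)] linkBl[OF abc(2,3,6) E3(3)] N3
      by blast+
    have "?W - {?a} = linkB k m ?b ?c" "?W - {?b} = linkB k m ?a ?c" "?W - {?c} = linkB k m ?a ?b"
      using abc nf by (auto simp: linkB_def)
    then have mono: "{?W - {?a}, ?W - {?b}, ?W - {?c}} \<subseteq> {e \<in> E. col e = \<beta>}" using E3 C3 by simp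
    have sub: "?W \<subseteq> blockB k m" using abc by (auto simp: blockB_def)
    have cW: "card ?W = Suc k"
      using abc nf k by (subst card_Un_disjoint) (auto simp: fixB_def)
    have fW: "finite ?W" by (simp add: fixB_def)
    have "has_F1 k (blockB k m) {e \<in> E. col e = \<beta>}"
      unfolding has_F1_def
      by (intro exI[of _ ?W] exI[of _ ?a] exI[of _ ?b] exI[of _ ?c] conjI mono sub cW fW)
         (use lt in auto)
    then show False using neg by simp
  qed
  then obtain \<phi> where \<phi>: "\<And>i. i \<in> Xs \<Longrightarrow> \<phi> i \<in> edgesB k m i \<and> \<phi> i \<in> Bl" by metis
  \<comment> \<open>Distinct triangles with the same chosen edge overlap, so both would be first
    components of pairs in \<open>Ys\<close>.\<close>
  have "inj_on \<phi> (Xs - fst ` Ys)"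
  proof (rule inj_onI, rule ccontr)
    fix i j assume ij: "i \<in> Xs - fst ` Ys" "j \<in> Xs - fst ` Ys" "\<phi> i = \<phi> j" "i \<noteq> j"
    have "\<phi> i \<in> edgesB k m i \<inter> edgesB k m j" using \<phi>[of i] \<phi>[of j] ij by simp
    then have "(i, j) \<in> Ys" using ij by (auto simp: Ys_def overlapB_def Xs_def)
    then show False using ij(1) by force
  qed
  then have "card (Xs - fst ` Ys) \<le> card Bl"
    using \<phi> finB by (intro card_inj_on_le) auto
  moreover have "card Xs \<le> card ((Xs - fst ` Ys) \<union> fst ` Ys)"
    using finX finY by (intro card_mono) auto
  then have "card Xs \<le> card (Xs - fst ` Ys) + card (fst ` Ys)"
    using card_Un_le order_trans by blast
  moreover have "card (fst ` Ys) \<le> card Ys" using finY by (rule card_image_le)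
  ultimately show False using many cB unfolding Xs_def[symmetric] Ys_def[symmetric] by linarith
qed

section \<open>Moment estimates for the three blocks\<close>

lemma ncontained_edges:
  assumes "\<And>j. j \<in> J \<Longrightarrow> A j \<subseteq> I"
  shows "ncontained A J X = card {j \<in> J. A j \<subseteq> {e \<in> I. X e}}"
proof -
  have "{j \<in> J. \<forall>e\<in>A j. X e} = {j \<in> J. A j \<subseteq> {e \<in> I. X e}}"
    using assms by auto
  then show ?thesis by (simp add: ncontained_def)
qed

lemma sum_overlap_disjoint:
  fixes p :: real
  assumes "finite J" "\<And>i j. i \<in> J \<Longrightarrow> j \<in> J \<Longrightarrow> A i \<inter> A j \<noteq> {} \<Longrightarrow> i = j" "0 \<le> p"
  shows "(\<Sum>(i, j)\<in>{(i, j) \<in> J \<times> J. A i \<inter> A j \<noteq> {}}. p ^ card (A i \<union> A j)) \<le> (\<Sum>j\<in>J. p ^ card (A j))"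
proof -
  have "(\<Sum>(i, j)\<in>{(i, j) \<in> J \<times> J. A i \<inter> A j \<noteq> {}}. p ^ card (A i \<union> A j)) \<le>
      (\<Sum>(i, j)\<in>(\<lambda>j. (j, j)) ` J. p ^ card (A i \<union> A j))"
    using assms by (intro sum_mono2) auto
  also have "\<dots> = (\<Sum>j\<in>J. p ^ card (A j))"
    by (subst sum.reindex) (auto simp: inj_on_def)
  finally show ?thesis .
qed

lemma not_arrows_cases:
  fixes X :: "nat set \<Rightarrow> bool"
  assumes k: "4 \<le> k" "k \<le> m" "15 * m \<le> n"
    and na: "\<not> arrows ({..<n}, {e \<in> nsets {..<n} k. X e}) (target k t)"
  shows "ncontained (edgesA k m) (indexA m) X = 0 \<or>
    ncontained (edgesC k m) {..<m} X < 2 * t \<or>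
    ncontained (edgesB k m) (indexB m) X \<le> 3 * m * t +
      ncontained (\<lambda>(i, j). edgesB k m i \<union> edgesB k m j) (overlapB k m) X"
proof (rule ccontr)
  assume neg: "\<not> ?thesis"
  define E where "E = {e \<in> nsets {..<n} k. X e}"
  have k2: "2 \<le> k" using k by simp
  have A: "ncontained (edgesA k m) (indexA m) X = card {j \<in> indexA m. edgesA k m j \<subseteq> E}"
    unfolding E_def using edgesA(1)[OF _ k] by (rule ncontained_edges)
  have C: "ncontained (edgesC k m) {..<m} X = card {j \<in> {..<m}. edgesC k m j \<subseteq> E}"
    unfolding E_def using edgesC_subset[OF _ _ k(2,3)] k by (intro ncontained_edges) auto
  have B: "ncontained (edgesB k m) (indexB m) X = card {j \<in> indexB m. edgesB k m j \<subseteq> E}"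
    unfolding E_def using edgesB(1)[OF _ k2 k(2,3)] by (rule ncontained_edges)
  have Y: "ncontained (\<lambda>(i, j). edgesB k m i \<union> edgesB k m j) (overlapB k m) X =
      card {x \<in> overlapB k m. (case x of (i, j) \<Rightarrow> edgesB k m i \<union> edgesB k m j) \<subseteq> E}"
    unfolding E_def
  proof (rule ncontained_edges)
    fix x assume "x \<in> overlapB k m"
    then obtain i j where "x = (i, j)" "i \<in> indexB m" "j \<in> indexB m" by (auto simp: overlapB_def)
    then show "(case x of (i, j) \<Rightarrow> edgesB k m i \<union> edgesB k m j) \<subseteq> nsets {..<n} k"
      using edgesB(1)[OF _ k2 k(2,3)] by simp
  qed
  have Y': "{x \<in> overlapB k m. (case x of (i, j) \<Rightarrow> edgesB k m i \<union> edgesB k m j) \<subseteq> E} =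
      {(i, j) \<in> overlapB k m. edgesB k m i \<union> edgesB k m j \<subseteq> E}" by auto
  have "{j \<in> indexA m. edgesA k m j \<subseteq> E} \<noteq> {}" using neg unfolding A by force
  then obtain q where q: "q \<in> indexA m" "edgesA k m q \<subseteq> E" by blast
  have "arrows ({..<n}, E) (target k t)"
  proof (rule arrows_target)
    show "\<exists>\<beta>. has_F1 k (blockA k m) {e \<in> E. col e = \<beta>}" for col :: "nat set \<Rightarrow> bool"
      using blockA_mono[OF q(1) k(1) q(2)] .
    show "\<exists>\<beta>. has_F2 k t (blockC k m) {e \<in> E. col e = \<beta>}" for col :: "nat set \<Rightarrow> bool"
      using neg k unfolding C by (intro blockC_mono) auto
    show "has_F1 k (blockB k m) {e \<in> E. col e = \<beta>} \<or> has_F2 k t (blockB k m) {e \<in> E. col e = (\<not> \<beta>)}"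
      for col :: "nat set \<Rightarrow> bool" and \<beta>
      using neg k2 k(2) unfolding B Y Y' by (intro blockB_asym) auto
    show "blockA k m \<inter> blockB k m = {}" "blockA k m \<inter> blockC k m = {}" "blockB k m \<inter> blockC k m = {}"
      using k by (auto simp: blockA_def blockB_def blockC_def fixA_def fixB_def fixC_def)
    show "blockA k m \<union> blockB k m \<union> blockC k m \<subseteq> {..<n}"
      using k by (auto simp: blockA_def blockB_def blockC_def fixA_def fixB_def fixC_def)
  qed fact
  then show False using na by (simp add: E_def)
qed

text \<open>Chebyshev's inequality bounds the three counts of complete edge systems from below by
  half their means, and Markov's inequality keeps the number of overlapping triangle pairs below
  \<open>m\<close>. Hypotheses \<open>B\<close> and \<open>C\<close> say that
  \<open>3 * m * t + m\<close> and \<open>2 * t\<close> are at most half of the means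
  \<open>\<mu>B\<close> and \<open>\<mu>C\<close>.\<close>

lemma prob_not_arrows_le:
  fixes p :: real
  assumes k: "4 \<le> k" "k \<le> m" "15 * m \<le> n" and p: "0 < p" "p \<le> 1"
    and B: "2 * (3 * real t + 1) \<le> real m ^ 2 * p ^ 3" and C: "4 * real t \<le> real m * p"
  shows "measure_pmf.prob (bern (nsets {..<n} k) p)
      {X. \<not> arrows ({..<n}, {e \<in> nsets {..<n} k. X e}) (target k t)} \<le>
    4 / (real m ^ 4 * p ^ 5) + 4 / (real m * p) +
    4 * (real m ^ 3 * p ^ 3 + 3 * real m ^ 4 * p ^ 5) / (real m ^ 3 * p ^ 3)\<^sup>2 +
    3 * real m ^ 4 * p ^ 5 / real m"
proof -
  let ?I = "nsets {..<n} k" and ?M = "bern (nsets {..<n} k) p"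
  let ?D = "\<lambda>(i, j). edgesB k m i \<union> edgesB k m j"
  have finI: "finite ?I" by (simp add: finite_imp_finite_nsets)
  have k2: "2 \<le> k" and m: "0 < real m" using k by auto
  have p': "0 \<le> p" using p by simp
  define \<mu>A \<mu>B \<mu>C where "\<mu>A = real m ^ 4 * p ^ 5" and "\<mu>B = real m ^ 3 * p ^ 3" and "\<mu>C = real m * p"
  have pos: "0 < \<mu>A" "0 < \<mu>B" "0 < \<mu>C" using m p by (auto simp: \<mu>A_def \<mu>B_def \<mu>C_def)
  have cA: "card (indexA m) = m ^ 4" and fA: "finite (indexA m)"
    by (simp_all add: indexA_def card_cartesian_product eval_nat_numeral)
  have sA: "\<mu>A = (\<Sum>j\<in>indexA m. p ^ card (edgesA k m j))"
    using edgesA(2)[OF _ k] by (simp add: \<mu>A_def cA)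
  have PA: "measure_pmf.prob ?M {X. real (ncontained (edgesA k m) (indexA m) X) \<le> \<mu>A / 2} \<le> 4 * \<mu>A / \<mu>A\<^sup>2"
  proof (rule prob_ncontained_le_half[OF finI fA _ p' p(2) sA pos(1)])
    show "edgesA k m j \<subseteq> ?I" if "j \<in> indexA m" for j using edgesA(1)[OF that k] .
    show "(\<Sum>(i, j)\<in>{(i, j) \<in> indexA m \<times> indexA m. edgesA k m i \<inter> edgesA k m j \<noteq> {}}.
        p ^ card (edgesA k m i \<union> edgesA k m j)) \<le> \<mu>A"
      unfolding sA by (rule sum_overlap_disjoint[OF fA edgesA_disjoint p'])
  qed
  have sC: "\<mu>C = (\<Sum>j\<in>{..<m}. p ^ card (edgesC k m j))"
    by (simp add: \<mu>C_def edgesC_def)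
  have PC: "measure_pmf.prob ?M {X. real (ncontained (edgesC k m) {..<m} X) \<le> \<mu>C / 2} \<le> 4 * \<mu>C / \<mu>C\<^sup>2"
  proof (rule prob_ncontained_le_half[OF finI _ _ p' p(2) sC pos(3)])
    show "edgesC k m j \<subseteq> ?I" if "j \<in> {..<m}" for j using edgesC_subset[of j m k n] that k by simp
    show "(\<Sum>(i, j)\<in>{(i, j) \<in> {..<m} \<times> {..<m}. edgesC k m i \<inter> edgesC k m j \<noteq> {}}.
        p ^ card (edgesC k m i \<union> edgesC k m j)) \<le> \<mu>C"
      unfolding sC using edgesC_disjoint[of _ m _ k] p' by (intro sum_overlap_disjoint) auto
  qed simp
  have sB: "\<mu>B = (\<Sum>j\<in>indexB m. p ^ card (edgesB k m j))"
    using edgesB(2)[OF _ k2 k(2,3)] by (simp add: \<mu>B_def card_indexB)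
  have "(\<Sum>x\<in>overlapB k m. p ^ card (?D x)) = (\<Sum>x\<in>overlapB k m. p ^ 5)"
    using card_edgesB_Un[OF _ k2 k(2)] by (intro sum.cong refl) auto
  also have "\<dots> = card (overlapB k m) * p ^ 5" by simp
  also have "\<dots> \<le> 3 * real m ^ 4 * p ^ 5"
    using of_nat_mono[OF card_overlapB_le[of k m], where 'a = real] p' by (intro mult_right_mono) auto
  finally have sY: "(\<Sum>x\<in>overlapB k m. p ^ card (?D x)) \<le> 3 * real m ^ 4 * p ^ 5" .
  have PB: "measure_pmf.prob ?M {X. real (ncontained (edgesB k m) (indexB m) X) \<le> \<mu>B / 2} \<le>
      4 * (\<mu>B + 3 * real m ^ 4 * p ^ 5) / \<mu>B\<^sup>2"
  proof (rule prob_ncontained_le_half[OF finI finite_indexB _ p' p(2) sB pos(2)])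
    show "edgesB k m j \<subseteq> ?I" if "j \<in> indexB m" for j using edgesB(1)[OF that k2 k(2,3)] .
    have fin: "finite ((\<lambda>j. (j, j)) ` indexB m)" "finite (overlapB k m)"
      by (simp_all add: finite_indexB finite_overlapB)
    \<comment> \<open>Overlapping pairs are the diagonal ones, contributing the mean, and those in
      \<open>overlapB\<close>, whose unions have five edges.\<close>
    have "(\<Sum>(i, j)\<in>{(i, j) \<in> indexB m \<times> indexB m. edgesB k m i \<inter> edgesB k m j \<noteq> {}}.
        p ^ card (edgesB k m i \<union> edgesB k m j)) \<le>
        (\<Sum>(i, j)\<in>(\<lambda>j. (j, j)) ` indexB m \<union> overlapB k m. p ^ card (edgesB k m i \<union> edgesB k m j))"
      using p' fin by (intro sum_mono2) (auto simp: overlapB_def)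
    also have "\<dots> = (\<Sum>(i, j)\<in>(\<lambda>j. (j, j)) ` indexB m. p ^ card (edgesB k m i \<union> edgesB k m j)) +
        (\<Sum>(i, j)\<in>overlapB k m. p ^ card (edgesB k m i \<union> edgesB k m j))"
      using fin by (intro sum.union_disjoint) (auto simp: overlapB_def)
    also have "(\<Sum>(i, j)\<in>(\<lambda>j. (j, j)) ` indexB m. p ^ card (edgesB k m i \<union> edgesB k m j)) = \<mu>B"
      unfolding sB by (subst sum.reindex) (auto simp: inj_on_def)
    also have "(\<Sum>(i, j)\<in>overlapB k m. p ^ card (edgesB k m i \<union> edgesB k m j)) \<le> 3 * real m ^ 4 * p ^ 5"
      using sY by (simp add: case_prod_unfold)
    finally show "(\<Sum>(i, j)\<in>{(i, j) \<in> indexB m \<times> indexB m. edgesB k m i \<inter> edgesB k m j \<noteq> {}}.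
        p ^ card (edgesB k m i \<union> edgesB k m j)) \<le> \<mu>B + 3 * real m ^ 4 * p ^ 5" by simp
  qed
  have "measure_pmf.prob ?M {X. real m \<le> real (ncontained ?D (overlapB k m) X)} \<le>
      (\<Sum>x\<in>overlapB k m. p ^ card (?D x)) / real m"
  proof (rule prob_ncontained_ge[OF finI finite_overlapB _ p' p(2) m])
    fix x assume "x \<in> overlapB k m"
    then obtain i j where "x = (i, j)" "i \<in> indexB m" "j \<in> indexB m" by (auto simp: overlapB_def)
    then show "?D x \<subseteq> ?I" using edgesB(1)[OF _ k2 k(2,3)] by simp
  qed
  also have "\<dots> \<le> 3 * real m ^ 4 * p ^ 5 / real m" using sY m by (intro divide_right_mono) auto
  finally have PY: "measure_pmf.prob ?M {X. real m \<le> real (ncontained ?D (overlapB k m) X)} \<le>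
      3 * real m ^ 4 * p ^ 5 / real m" .
  let ?SA = "{X. real (ncontained (edgesA k m) (indexA m) X) \<le> \<mu>A / 2}"
  let ?SB = "{X. real (ncontained (edgesB k m) (indexB m) X) \<le> \<mu>B / 2}"
  let ?SC = "{X. real (ncontained (edgesC k m) {..<m} X) \<le> \<mu>C / 2}"
  let ?SY = "{X. real m \<le> real (ncontained ?D (overlapB k m) X)}"
  have "{X. \<not> arrows ({..<n}, {e \<in> ?I. X e}) (target k t)} \<subseteq> ?SA \<union> ?SC \<union> ?SB \<union> ?SY"
  proof
    fix X assume "X \<in> {X. \<not> arrows ({..<n}, {e \<in> ?I. X e}) (target k t)}"
    then have "\<not> arrows ({..<n}, {e \<in> ?I. X e}) (target k t)" by simp
    from not_arrows_cases[OF k this]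
    show "X \<in> ?SA \<union> ?SC \<union> ?SB \<union> ?SY"
    proof (elim disjE)
      assume "ncontained (edgesA k m) (indexA m) X = 0"
      then show ?thesis using pos by simp
    next
      assume "ncontained (edgesC k m) {..<m} X < 2 * t"
      then have "real (ncontained (edgesC k m) {..<m} X) \<le> real (2 * t)"
        by (simp only: of_nat_le_iff less_imp_le)
      then have "X \<in> ?SC" using C by (simp add: \<mu>C_def)
      then show ?thesis by simp
    next
      assume le: "ncontained (edgesB k m) (indexB m) X \<le> 3 * m * t + ncontained ?D (overlapB k m) X"
      show ?thesis
      proof (cases "X \<in> ?SY")
        case False
        have "real (ncontained (edgesB k m) (indexB m) X) \<le> real (3 * m * t + ncontained ?D (overlapB k m) X)"
          using le by (simp only: of_nat_le_iff)
        also have "\<dots> \<le> real m * (3 * real t + 1)" using False by (simp add: algebra_simps)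
        also have "\<dots> \<le> real m * (real m ^ 2 * p ^ 3 / 2)" using B m by (intro mult_left_mono) auto
        also have "\<dots> = \<mu>B / 2" by (simp add: \<mu>B_def power2_eq_square power3_eq_cube)
        finally show ?thesis by simp
      qed simp
    qed
  qed
  then have "measure_pmf.prob ?M {X. \<not> arrows ({..<n}, {e \<in> ?I. X e}) (target k t)} \<le>
      measure_pmf.prob ?M (?SA \<union> ?SC \<union> ?SB \<union> ?SY)"
    by (intro measure_pmf.finite_measure_mono) auto
  also have "\<dots> \<le> measure_pmf.prob ?M (?SA \<union> ?SC \<union> ?SB) + measure_pmf.prob ?M ?SY"
    by (rule measure_Un_le) auto
  also have "measure_pmf.prob ?M (?SA \<union> ?SC \<union> ?SB) \<le>
      measure_pmf.prob ?M (?SA \<union> ?SC) + measure_pmf.prob ?M ?SB"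
    by (rule measure_Un_le) auto
  also have "measure_pmf.prob ?M (?SA \<union> ?SC) \<le> measure_pmf.prob ?M ?SA + measure_pmf.prob ?M ?SC"
    by (rule measure_Un_le) auto
  finally have "measure_pmf.prob ?M {X. \<not> arrows ({..<n}, {e \<in> ?I. X e}) (target k t)} \<le>
      4 * \<mu>A / \<mu>A\<^sup>2 + 4 * \<mu>C / \<mu>C\<^sup>2 + 4 * (\<mu>B + 3 * real m ^ 4 * p ^ 5) / \<mu>B\<^sup>2 +
      3 * real m ^ 4 * p ^ 5 / real m"
    using PA PB PC PY by linarith
  moreover have "4 * \<mu>A / \<mu>A\<^sup>2 = 4 / \<mu>A" "4 * \<mu>C / \<mu>C\<^sup>2 = 4 / \<mu>C"
    using pos by (simp_all add: power2_eq_square)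
  ultimately show ?thesis by (simp add: \<mu>A_def \<mu>B_def \<mu>C_def)
qed

section \<open>Monotonicity in \<open>p\<close> and the limit\<close>

lemma arrows_mono:
  assumes "arrows (V, E) F" "E \<subseteq> E'"
  shows "arrows (V, E') F"
  unfolding arrows_def
proof
  fix col :: "'a set \<Rightarrow> bool"
  obtain H b where "subhypergraph H (V, E)" "hypergraph_iso H F" "\<forall>e\<in>hedges H. col e = b"
    using assms(1) unfolding arrows_def by blast
  moreover from this(1) have "subhypergraph H (V, E')"
    using assms(2) by (auto simp: subhypergraph_def)
  ultimately show "\<exists>H b. subhypergraph H (V, E') \<and> hypergraph_iso H F \<and> (\<forall>e\<in>hedges H. col e = b)"
    by blast
qed

text \<open>Reduces the 1-statement to the case where \<open>p\<close> equals
  \<open>C * n powr (- 2 / 3)\<close>, in which upper bounds on \<open>p\<close> are available for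
  the overlap terms.\<close>

lemma prob_arrows_mono:
  assumes "0 \<le> p" "p \<le> q" "q \<le> 1"
  shows "measure_pmf.prob (random_hypergraph k n p) {G. arrows G F} \<le>
    measure_pmf.prob (random_hypergraph k n q) {G. arrows G F}"
  unfolding prob_random_hypergraph
proof (rule prob_bern_mono[OF _ assms])
  fix X Y :: "nat set \<Rightarrow> bool"
  assume "\<And>e. X e \<Longrightarrow> Y e" "arrows ({..<n}, {e \<in> nsets {..<n} k. X e}) F"
  then show "arrows ({..<n}, {e \<in> nsets {..<n} k. Y e}) F"
    by (elim arrows_mono) auto
qed (simp add: finite_imp_finite_nsets)

text \<open>With \<open>m = n div 15\<close> the quantity \<open>m ^ 2 * q ^ 3\<close> tends to
  \<open>C ^ 3 / 225\<close>. As \<open>C ^ 3 \<ge> C\<close> and 1800 / 225 = 8, the limit exceeds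
  \<open>2 * (3 * t + 1)\<close>, as the triangle count demands.\<close>

lemma one_statement:
  fixes p :: "nat \<Rightarrow> real"
  assumes k: "4 \<le> k" and p: "\<And>n. 0 \<le> p n \<and> p n \<le> 1"
    and C: "C = 1800 * (3 * real t + 1)"
    and ge: "\<forall>\<^sub>F n in sequentially. C * real n powr (- 2 / 3) \<le> p n"
  shows "(\<lambda>n. measure_pmf.prob (random_hypergraph k n (p n)) {G. arrows G (target k t)}) \<longlonglongrightarrow> 1"
proof -
  define m where "m n = real_of_int \<lfloor>real n / 15\<rfloor>" for n
  define q where "q n = C * real n powr (- 2 / 3)" for n
  define h where "h n = 4 / (m n ^ 4 * q n ^ 5) + 4 / (m n * q n) +
    4 * (m n ^ 3 * q n ^ 3 + 3 * m n ^ 4 * q n ^ 5) / (m n ^ 3 * q n ^ 3)\<^sup>2 +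
    3 * m n ^ 4 * q n ^ 5 / m n" for n
  have C0: "0 < C" and C1: "1 \<le> C" by (auto simp: C)
  \<comment> \<open>The four terms are of order \<open>n\<close> to the powers -2/3, -1/3, -1 and
    -1/3.\<close>
  have h: "h \<longlonglongrightarrow> 0" unfolding h_def m_def q_def using C0 by real_asymp
  have m_eq: "real (n div 15) = m n" for n
    by (simp add: m_def floor_divide_of_nat_eq[of n 15, simplified])
  have "C ^ 1 \<le> C ^ 3" using C1 by (intro power_increasing) auto
  then have Clarge: "2 * (3 * real t + 1) < (1 / 15)\<^sup>2 * C ^ 3"
    by (simp add: C power2_eq_square)
  have "(\<lambda>n. m n ^ 2 * q n ^ 3) \<longlonglongrightarrow> (1 / 15)\<^sup>2 * C ^ 3"
    unfolding m_def q_def using C0 by real_asymp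
  then have evB: "\<forall>\<^sub>F n in sequentially. 2 * (3 * real t + 1) < m n ^ 2 * q n ^ 3"
    using Clarge by (rule order_tendstoD)
  have "filterlim (\<lambda>n. m n * q n) at_top sequentially"
    unfolding m_def q_def using C0 by real_asymp
  then have evC: "\<forall>\<^sub>F n in sequentially. 4 * real t \<le> m n * q n"
    by (simp add: filterlim_at_top)
  have lower: "\<forall>\<^sub>F n in sequentially. 1 - h n \<le>
      measure_pmf.prob (random_hypergraph k n (p n)) {G. arrows G (target k t)}"
    using ge evB evC eventually_ge_at_top[of "15 * k"]
  proof eventually_elim
    case (elim n)
    let ?M = "bern (nsets {..<n} k) (q n)"
    have km: "k \<le> n div 15" "15 * (n div 15) \<le> n" using elim(4) by auto
    have "0 < n" using elim(4) k by simp
    \<comment> \<open>The bound \<open>q n \<le> 1\<close> comes from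
      \<open>q n \<le> p n\<close>.\<close>
    then have q: "0 < q n" "q n \<le> 1" using C0 elim(1) p[of n] by (auto simp: q_def)
    let ?S = "{X. arrows ({..<n}, {e \<in> nsets {..<n} k. X e}) (target k t)}"
    have "measure_pmf.prob ?M (- ?S) \<le> h n"
      using prob_not_arrows_le[OF k km q, of t] elim(2,3)
      by (simp add: m_eq h_def Collect_neg_eq less_imp_le)
    moreover have "measure_pmf.prob ?M (- ?S) = 1 - measure_pmf.prob ?M ?S"
      using measure_pmf.prob_compl[of ?S ?M] by (simp add: Compl_eq_Diff_UNIV)
    ultimately have "1 - h n \<le> measure_pmf.prob ?M ?S" by linarith
    also have "\<dots> = measure_pmf.prob (random_hypergraph k n (q n)) {G. arrows G (target k t)}"
      by (rule prob_random_hypergraph[symmetric])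
    also have "\<dots> \<le> measure_pmf.prob (random_hypergraph k n (p n)) {G. arrows G (target k t)}"
      using elim(1) q(1) p[of n] by (intro prob_arrows_mono) (auto simp: q_def)
    finally show ?case .
  qed
  have lim: "(\<lambda>n. 1 - h n) \<longlonglongrightarrow> 1" using tendsto_diff[OF tendsto_const h, of 1] by simp
  show ?thesis
    by (rule tendsto_sandwich[OF lower _ lim tendsto_const]) (simp add: measure_pmf.prob_le_1)
qed

theorem theorem1p3:
  fixes k :: nat
  assumes "k \<ge> 4"
  shows "\<exists>(F :: nat hypergraph) (\<theta> :: real) (c :: real) (C :: real).
           uniform_hypergraph k F \<and> c > 0 \<and> C > 0 \<and> 1 < \<theta> \<and> \<theta> < m_density k F \<and>
           (\<forall>p :: nat \<Rightarrow> real. (\<forall>n. 0 \<le> p n \<and> p n \<le> 1) \<longrightarrow>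
              ((\<forall>\<^sub>F n in sequentially. p n \<le> c * real n powr (- 1 / \<theta>)) \<longrightarrow>
                 (\<lambda>n. measure_pmf.prob (random_hypergraph k n (p n)) {G. arrows G F})
                   \<longlonglongrightarrow> 0) \<and>
              ((\<forall>\<^sub>F n in sequentially. p n \<ge> C * real n powr (- 1 / \<theta>)) \<longrightarrow>
                 (\<lambda>n. measure_pmf.prob (random_hypergraph k n (p n)) {G. arrows G F})
                   \<longlonglongrightarrow> 1))"
proof -
  let ?t = "12 * k ^ 2"
  let ?F = "target k ?t" and ?C = "1800 * (3 * real ?t + 1)"
  have k2: "2 \<le> k" using assms by simp
  have "0 < lower_const k" using assms by (simp add: lower_const_def triple_bound_def)
  moreover have "0 < ?C" by (simp add: add_nonneg_pos)
  moreover have "3 / 2 < m_density k ?F" using m_density_target[OF k2, of ?t] by linarith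
  moreover have "- 1 / (3 / 2) = (- 2 / 3 :: real)" by simp
  moreover have "(\<lambda>n. measure_pmf.prob (random_hypergraph k n (p n)) {G. arrows G ?F}) \<longlonglongrightarrow> 0"
    if "\<forall>n. 0 \<le> p n \<and> p n \<le> 1" "\<forall>\<^sub>F n in sequentially. p n \<le> lower_const k * real n powr (- 2 / 3)"
    for p :: "nat \<Rightarrow> real"
    using that by (intro zero_statement[OF k2]) auto
  moreover have "(\<lambda>n. measure_pmf.prob (random_hypergraph k n (p n)) {G. arrows G ?F}) \<longlonglongrightarrow> 1"
    if "\<forall>n. 0 \<le> p n \<and> p n \<le> 1" "\<forall>\<^sub>F n in sequentially. ?C * real n powr (- 2 / 3) \<le> p n"
    for p :: "nat \<Rightarrow> real"
    using that by (intro one_statement[OF assms _ refl]) auto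
  ultimately show ?thesis
    using uniform_target[OF k2, of ?t]
    by (intro exI[of _ ?F] exI[of _ "3 / 2 :: real"] exI[of _ "lower_const k"] exI[of _ ?C] conjI allI impI)
       (simp_all del: of_nat_mult of_nat_power)
qed

end
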